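(* Let $\Gamma$ be a finite simplicial graph with a labeling $m : E(\Gamma) \to \mathbb{N}_{\ge 2}$, let $A = A[\Gamma]$ be its Artin group, and let $X \subset V(\Gamma)$. Let $\hat\pi_X : (\Sigma \sqcup \Sigma^{-1})^* \to (\Sigma_X \sqcup \Sigma_X^{-1})^*$ be the map on words defined in the context. (1) Let $\hat\alpha, \hat\beta \in (\Sigma \sqcup \Sigma^{-1})^*$. If $\hat\alpha$ and $\hat\beta$ represent the same element of $A$, then $\hat\pi_X(\hat\alpha)$ and $\hat\pi_X(\hat\beta)$ represent the same element of $A_X$. In other words, the map $\hat\pi_X$ induces a set-map $\pi_X : A \to A_X$. (2) We have $\pi_X(\alpha) = \alpha$ for all $\alpha \in A_X$. (3) The restriction of $\pi_X$ to $\mathrm{CA}$ is a homomorphism $\pi_X : \mathrm{CA} \to \mathrm{CA}_X$.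
   Context: For letters $a,b$ and an integer $m \ge 2$, $\mathrm{Prod}(a,b,m)$ denotes the alternating word $aba\cdots$ of length $m$ (starting with $a$). Let $\Gamma$ be a finite simplicial graph with vertex set $V(\Gamma)$, edge set $E(\Gamma)$ and labeling $m : E(\Gamma) \to \mathbb{N}_{\ge 2}$. With $\Sigma = \{\sigma_x \mid x \in V(\Gamma)\}$ an abstract set in one-to-one correspondence with $V(\Gamma)$, the Artin group of $\Gamma$ is $$A = A[\Gamma] = \langle \Sigma \mid \mathrm{Prod}(\sigma_x,\sigma_y,m(e)) = \mathrm{Prod}(\sigma_y,\sigma_x,m(e)) \text{ for } e = \{x,y\} \in E(\Gamma) \rangle.$$ With $S = \{s_x \mid x \in V(\Gamma)\}$ an abstract set in one-to-one correspondence with $V(\Gamma)$, the Coxeter group of $\Gamma$ is $$W = W[\Gamma] = \langle S \mid \mathrm{Prod}(s_x,s_y,m(e)) = \mathrm{Prod}(s_y,s_x,m(e)) \text{ for } e = \{x,y\} \in E(\Gamma),\ s_x^2 = 1 \text{ for } x \in V(\Gamma) \rangle.$$ For $X \subset V(\Gamma)$: $\Sigma_X = \{\sigma_x \mid x \in X\}$, $A_X$ is the subgroup of $A$ generated by $\Sigma_X$; $S_X = \{s_x \mid x \in X\}$, $W_X$ is the subgroup of $W$ generated by $S_X$. Let $\theta : A \to W$ be the epimorphism sending $\sigma_x$ to $s_x$ for all $x \in V(\Gamma)$; its kernel is the colored Artin group $\mathrm{CA} = \mathrm{CA}[\Gamma]$, and $\mathrm{CA}_X = \mathrm{CA} \cap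 A_X$. The word length of $w \in W$ with respect to $S$ is $\ell_S(w)$. An element $w \in W$ is called $(X,\emptyset)$-minimal if it is of minimal length in the coset $W_X w$; each such coset has a unique element of minimal length, so each $u \in W$ is written uniquely as $u = vw$ with $v \in W_X$ and $w$ $(X,\emptyset)$-minimal. $(\Sigma \sqcup \Sigma^{-1})^*$ denotes the free monoid of words over the alphabet $\Sigma \sqcup \Sigma^{-1}$, and similarly for $\Sigma_X$. Definition of $\hat\pi_X$: let $\hat\alpha = \sigma_{z_1}^{\varepsilon_1} \sigma_{z_2}^{\varepsilon_2} \cdots \sigma_{z_p}^{\varepsilon_p} \in (\Sigma \sqcup \Sigma^{-1})^*$ (each $\varepsilon_i \in \{1,-1\}$). Set $u_0 = 1 \in W$ and $u_i = s_{z_1} s_{z_2} \cdots s_{z_i} \in W$ for $i \in \{1,\dots,p\}$. Write each $u_i$ in the form $u_i = v_i w_i$ where $v_i \in W_X$ and $w_i$ is $(X,\emptyset)$-minimal. For $i \in \{1,\dots,p\}$ set $t_i = w_{i-1} s_{z_i} w_{i-1}^{-1}$ if $\varepsilon_i = 1$ and $t_i = w_i s_{z_i} w_i^{-1}$ if $\varepsilon_i = -1$. If $t_i \notin S_X$, set $\tau_i = 1$ (the empty word). If $t_i \in S_X$, let $x_i \in X$ be such that $t_i = s_{x_i}$ and set $\tau_i = \sigma_{x_i}^{\varepsilon_i}$. Finally set $$\hat\pi_X(\hat\alpha) = \tau_1 \tau_2 \cdots \tau_p \in (\Sigma_X \sqcup \Sigma_X^{-1})^*.$$ *)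

theory Defs
  imports "HOL-Algebra.Coset" "HOL-Algebra.Generated_Groups"
begin

section \<open>Groups given by generators and relations\<close>

text \<open>The letter \<open>(x, True)\<close> stands for the generator \<open>x\<close>, the letter \<open>(x, False)\<close> for its
  formal inverse.\<close>

type_synonym 'a signed_word = "('a \<times> bool) list"

definition signed_words :: "'a set \<Rightarrow> 'a signed_word set" where
  "signed_words V = lists (V \<times> UNIV)"

text \<open>The smallest monoid congruence on \<open>signed_words V\<close> that contains the relations \<open>R\<close> and
  cancels \<open>x x\<^sup>-\<^sup>1\<close> and \<open>x\<^sup>-\<^sup>1 x\<close>; its quotient is the group presented by \<open>V\<close> and \<open>R\<close>.\<close>

inductive_set pres_rel :: "'a set \<Rightarrow> 'a signed_word rel \<Rightarrow> 'a signed_word rel"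
  for V :: "'a set" and R :: "'a signed_word rel" where
  refl: "u \<in> signed_words V \<Longrightarrow> (u, u) \<in> pres_rel V R"
| sym: "(u, v) \<in> pres_rel V R \<Longrightarrow> (v, u) \<in> pres_rel V R"
| trans: "(u, v) \<in> pres_rel V R \<Longrightarrow> (v, w) \<in> pres_rel V R \<Longrightarrow> (u, w) \<in> pres_rel V R"
| append: "(u, v) \<in> pres_rel V R \<Longrightarrow> (u', v') \<in> pres_rel V R \<Longrightarrow> (u @ u', v @ v') \<in> pres_rel V R"
| cancel: "x \<in> V \<Longrightarrow> ([(x, e), (x, \<not> e)], []) \<in> pres_rel V R"
| relation: "(u, v) \<in> R \<Longrightarrow> (u, v) \<in> pres_rel V R"

definition word_class :: "'a set \<Rightarrow> 'a signed_word rel \<Rightarrow> 'a signed_word \<Rightarrow> 'a signed_word set" where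
  "word_class V R u = pres_rel V R `` {u}"

definition presented_group :: "'a set \<Rightarrow> 'a signed_word rel \<Rightarrow> 'a signed_word set monoid" where
  "presented_group V R =
     \<lparr>carrier = signed_words V // pres_rel V R,
      mult = (\<lambda>a b. \<Union>u\<in>a. \<Union>v\<in>b. word_class V R (u @ v)),
      one = word_class V R []\<rparr>"

locale presentation =
  fixes V :: "'a set" and R :: "'a signed_word rel"
  assumes relations_wf: "R \<subseteq> signed_words V \<times> signed_words V"
begin

lemma pres_rel_wf: "(u, v) \<in> pres_rel V R \<Longrightarrow> u \<in> signed_words V \<and> v \<in> signed_words V"
  by (induction rule: pres_rel.induct) (use relations_wf in \<open>auto simp: signed_words_def\<close>)

lemma equiv_pres_rel: "equiv (signed_words V) (pres_rel V R)"
proof (rule equivI)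
  show "pres_rel V R \<subseteq> signed_words V \<times> signed_words V"
    using pres_rel_wf by auto
qed (auto simp: refl_on_def sym_def trans_def dest: pres_rel_wf
       intro: pres_rel.refl pres_rel.sym pres_rel.trans)

lemma word_class_eq_iff:
  "u \<in> signed_words V \<Longrightarrow> v \<in> signed_words V \<Longrightarrow>
     word_class V R u = word_class V R v \<longleftrightarrow> (u, v) \<in> pres_rel V R"
  unfolding word_class_def using eq_equiv_class_iff[OF equiv_pres_rel] by blast

lemma word_class_eqI: "(u, v) \<in> pres_rel V R \<Longrightarrow> word_class V R u = word_class V R v"
  unfolding word_class_def by (rule equiv_class_eq[OF equiv_pres_rel])

lemma carrier_eq: "carrier (presented_group V R) = word_class V R ` signed_words V"
  by (auto simp: presented_group_def quotient_def word_class_def)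

lemma word_class_induced:
  assumes "u \<in> signed_words V"
    and "\<And>u'. (u, u') \<in> pres_rel V R \<Longrightarrow> f u' = f u"
  shows "(\<Union>u'\<in>word_class V R u. f u') = f u"
proof -
  have "u \<in> word_class V R u"
    using assms(1) by (auto simp: word_class_def intro: pres_rel.refl)
  moreover have "f u' = f u" if "u' \<in> word_class V R u" for u'
    using that assms(2) by (auto simp: word_class_def)
  ultimately show ?thesis by blast
qed

lemma mult_word_class:
  assumes u: "u \<in> signed_words V" and v: "v \<in> signed_words V"
  shows "word_class V R u \<otimes>\<^bsub>presented_group V R\<^esub> word_class V R v = word_class V R (u @ v)"
proof -
  have 1: "(\<Union>v'\<in>word_class V R v. word_class V R (u' @ v')) = word_class V R (u' @ v)"
    if "u' \<in> signed_words V" for u'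
    by (rule word_class_induced[OF v])
       (auto intro!: word_class_eqI intro: pres_rel.append pres_rel.refl pres_rel.sym that)
  have "(\<Union>u'\<in>word_class V R u. \<Union>v'\<in>word_class V R v. word_class V R (u' @ v'))
      = (\<Union>v'\<in>word_class V R v. word_class V R (u @ v'))"
  proof (rule word_class_induced[OF u])
    fix u' assume "(u, u') \<in> pres_rel V R"
    then show "(\<Union>v'\<in>word_class V R v. word_class V R (u' @ v'))
             = (\<Union>v'\<in>word_class V R v. word_class V R (u @ v'))"
      using 1 u v pres_rel_wf
      by (metis pres_rel.append pres_rel.refl word_class_eqI)
  qed
  then show ?thesis using 1[OF u] by (simp add: presented_group_def)
qed

lemma left_inverse:
  "u \<in> signed_words V \<Longrightarrow> \<exists>v\<in>signed_words V. (v @ u, []) \<in> pres_rel V R"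
proof (induction u)
  case Nil
  then show ?case using pres_rel.refl[OF Nil] by force
next
  case (Cons p u)
  obtain x e where p: "p = (x, e)" by (cases p)
  have x: "x \<in> V" and u: "u \<in> signed_words V"
    using Cons.prems by (auto simp: p signed_words_def)
  obtain v where v: "v \<in> signed_words V" "(v @ u, []) \<in> pres_rel V R"
    using Cons.IH[OF u] by blast
  have "([(x, \<not> e), (x, e)], []) \<in> pres_rel V R"
    using pres_rel.cancel[OF x, of "\<not> e"] by simp
  then have "([(x, \<not> e), (x, e)] @ u, [] @ u) \<in> pres_rel V R"
    by (rule pres_rel.append) (rule pres_rel.refl[OF u])
  then have "(v @ ([(x, \<not> e), (x, e)] @ u), v @ ([] @ u)) \<in> pres_rel V R"
    by (rule pres_rel.append[OF pres_rel.refl[OF v(1)]])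
  then have "((v @ [(x, \<not> e)]) @ p # u, []) \<in> pres_rel V R"
    using pres_rel.trans[OF _ v(2)] by (simp add: p)
  moreover have "v @ [(x, \<not> e)] \<in> signed_words V"
    using v x by (auto simp: signed_words_def)
  ultimately show ?case by blast
qed

lemma one_eq: "\<one>\<^bsub>presented_group V R\<^esub> = word_class V R []"
  by (simp add: presented_group_def)

lemma signed_words_append [simp]:
  "u @ v \<in> signed_words V \<longleftrightarrow> u \<in> signed_words V \<and> v \<in> signed_words V"
  by (simp add: signed_words_def)

lemma signed_words_Nil [simp]: "[] \<in> signed_words V"
  by (simp add: signed_words_def)

lemma group_presented_group: "group (presented_group V R)"
proof (rule groupI)
  fix a assume "a \<in> carrier (presented_group V R)"
  then obtain u where u: "u \<in> signed_words V" "a = word_class V R u"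
    by (auto simp: carrier_eq)
  obtain v where v: "v \<in> signed_words V" "(v @ u, []) \<in> pres_rel V R"
    using left_inverse[OF u(1)] by blast
  have "word_class V R v \<otimes>\<^bsub>presented_group V R\<^esub> a = \<one>\<^bsub>presented_group V R\<^esub>"
    using u v by (simp add: mult_word_class one_eq word_class_eqI)
  then show "\<exists>b\<in>carrier (presented_group V R).
      b \<otimes>\<^bsub>presented_group V R\<^esub> a = \<one>\<^bsub>presented_group V R\<^esub>"
    using v by (auto simp: carrier_eq)
qed (auto simp: carrier_eq one_eq mult_word_class)

end

section \<open>Artin groups and Coxeter groups\<close>

text \<open>Edges are two-element sets of vertices; the labels of other sets are irrelevant.\<close>

record 'v labelled_graph =
  verts :: "'v set"
  edges :: "'v set set"
  label :: "'v set \<Rightarrow> nat"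

definition wf_labelled_graph :: "'v labelled_graph \<Rightarrow> bool" where
  "wf_labelled_graph \<Gamma> \<longleftrightarrow>
     finite (verts \<Gamma>) \<and>
     edges \<Gamma> \<subseteq> {{x, y} | x y. x \<in> verts \<Gamma> \<and> y \<in> verts \<Gamma> \<and> x \<noteq> y} \<and>
     (\<forall>e\<in>edges \<Gamma>. 2 \<le> label \<Gamma> e)"

fun alternating :: "'a \<Rightarrow> 'a \<Rightarrow> nat \<Rightarrow> 'a list" where
  "alternating a b 0 = []"
| "alternating a b (Suc n) = a # alternating b a n"

definition artin_relations :: "'v labelled_graph \<Rightarrow> 'v signed_word rel" where
  "artin_relations \<Gamma> =
     {(alternating (x, True) (y, True) (label \<Gamma> {x, y}),
       alternating (y, True) (x, True) (label \<Gamma> {x, y})) | x y. {x, y} \<in> edges \<Gamma>}"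

definition coxeter_relations :: "'v labelled_graph \<Rightarrow> 'v signed_word rel" where
  "coxeter_relations \<Gamma> = artin_relations \<Gamma> \<union> {([(x, True), (x, True)], []) | x. x \<in> verts \<Gamma>}"

abbreviation artin_class :: "'v labelled_graph \<Rightarrow> 'v signed_word \<Rightarrow> 'v signed_word set" where
  "artin_class \<Gamma> \<equiv> word_class (verts \<Gamma>) (artin_relations \<Gamma>)"

abbreviation coxeter_class :: "'v labelled_graph \<Rightarrow> 'v signed_word \<Rightarrow> 'v signed_word set" where
  "coxeter_class \<Gamma> \<equiv> word_class (verts \<Gamma>) (coxeter_relations \<Gamma>)"

definition artin_group :: "'v labelled_graph \<Rightarrow> 'v signed_word set monoid" where
  "artin_group \<Gamma> = presented_group (verts \<Gamma>) (artin_relations \<Gamma>)"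

definition coxeter_group :: "'v labelled_graph \<Rightarrow> 'v signed_word set monoid" where
  "coxeter_group \<Gamma> = presented_group (verts \<Gamma>) (coxeter_relations \<Gamma>)"

definition artin_gen :: "'v labelled_graph \<Rightarrow> 'v \<Rightarrow> 'v signed_word set" where
  "artin_gen \<Gamma> x = artin_class \<Gamma> [(x, True)]"

definition cox_gen :: "'v labelled_graph \<Rightarrow> 'v \<Rightarrow> 'v signed_word set" where
  "cox_gen \<Gamma> x = coxeter_class \<Gamma> [(x, True)]"

definition artin_subgroup :: "'v labelled_graph \<Rightarrow> 'v set \<Rightarrow> 'v signed_word set set" where
  "artin_subgroup \<Gamma> X = generate (artin_group \<Gamma>) (artin_gen \<Gamma> ` X)"

definition cox_subgroup :: "'v labelled_graph \<Rightarrow> 'v set \<Rightarrow> 'v signed_word set set" where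
  "cox_subgroup \<Gamma> X = generate (coxeter_group \<Gamma>) (cox_gen \<Gamma> ` X)"

text \<open>All words in the class \<open>a\<close> represent the same element of the Coxeter group, so the union is
  over a single set; see \<open>artin_to_coxeter_class\<close>, \<open>artin_to_coxeter_gen\<close>,
  \<open>artin_to_coxeter_hom\<close> and \<open>artin_to_coxeter_surj\<close>.\<close>

definition artin_to_coxeter :: "'v labelled_graph \<Rightarrow> 'v signed_word set \<Rightarrow> 'v signed_word set" where
  "artin_to_coxeter \<Gamma> a = (\<Union>u\<in>a. coxeter_class \<Gamma> u)"

definition colored_artin :: "'v labelled_graph \<Rightarrow> 'v signed_word set set" where
  "colored_artin \<Gamma> = kernel (artin_group \<Gamma>) (coxeter_group \<Gamma>) (artin_to_coxeter \<Gamma>)"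

definition colored_artin_sub :: "'v labelled_graph \<Rightarrow> 'v set \<Rightarrow> 'v signed_word set set" where
  "colored_artin_sub \<Gamma> X = colored_artin \<Gamma> \<inter> artin_subgroup \<Gamma> X"

lemma set_alternating: "set (alternating a b n) \<subseteq> {a, b}"
  by (induction n arbitrary: a b) auto

lemma artin_relations_wf:
  assumes "wf_labelled_graph \<Gamma>"
  shows "artin_relations \<Gamma> \<subseteq> signed_words (verts \<Gamma>) \<times> signed_words (verts \<Gamma>)"
proof -
  have "x \<in> verts \<Gamma> \<and> y \<in> verts \<Gamma>" if "{x, y} \<in> edges \<Gamma>" for x y
    using assms that unfolding wf_labelled_graph_def by (auto simp: doubleton_eq_iff)
  then show ?thesis
    using set_alternating unfolding artin_relations_def signed_words_def lists_eq_set by fastforce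
qed

lemma artin_presentation:
  "wf_labelled_graph \<Gamma> \<Longrightarrow> presentation (verts \<Gamma>) (artin_relations \<Gamma>)"
  by unfold_locales (rule artin_relations_wf)

lemma coxeter_presentation:
  "wf_labelled_graph \<Gamma> \<Longrightarrow> presentation (verts \<Gamma>) (coxeter_relations \<Gamma>)"
  using artin_relations_wf[of \<Gamma>]
  by unfold_locales (auto simp: coxeter_relations_def signed_words_def lists_eq_set)

lemma group_artin_group: "wf_labelled_graph \<Gamma> \<Longrightarrow> group (artin_group \<Gamma>)"
  unfolding artin_group_def
  by (rule presentation.group_presented_group[OF artin_presentation])

lemma group_coxeter_group: "wf_labelled_graph \<Gamma> \<Longrightarrow> group (coxeter_group \<Gamma>)"
  unfolding coxeter_group_def
  by (rule presentation.group_presented_group[OF coxeter_presentation])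

lemma pres_rel_mono: "(u, v) \<in> pres_rel V R \<Longrightarrow> R \<subseteq> R' \<Longrightarrow> (u, v) \<in> pres_rel V R'"
  by (induction rule: pres_rel.induct) (auto intro: pres_rel.intros)

lemma artin_to_coxeter_class:
  assumes \<Gamma>: "wf_labelled_graph \<Gamma>" and u: "u \<in> signed_words (verts \<Gamma>)"
  shows "artin_to_coxeter \<Gamma> (artin_class \<Gamma> u) = coxeter_class \<Gamma> u"
  unfolding artin_to_coxeter_def
proof (rule presentation.word_class_induced[OF artin_presentation[OF \<Gamma>] u])
  fix u' assume "(u, u') \<in> pres_rel (verts \<Gamma>) (artin_relations \<Gamma>)"
  then have "(u', u) \<in> pres_rel (verts \<Gamma>) (coxeter_relations \<Gamma>)"
    by (rule pres_rel.sym[OF pres_rel_mono]) (simp add: coxeter_relations_def)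
  then show "coxeter_class \<Gamma> u' = coxeter_class \<Gamma> u"
    by (rule presentation.word_class_eqI[OF coxeter_presentation[OF \<Gamma>]])
qed

lemma artin_to_coxeter_gen:
  "wf_labelled_graph \<Gamma> \<Longrightarrow> x \<in> verts \<Gamma> \<Longrightarrow> artin_to_coxeter \<Gamma> (artin_gen \<Gamma> x) = cox_gen \<Gamma> x"
  unfolding artin_gen_def cox_gen_def
  by (rule artin_to_coxeter_class) (auto simp: signed_words_def)

lemma artin_to_coxeter_hom:
  assumes \<Gamma>: "wf_labelled_graph \<Gamma>"
  shows "artin_to_coxeter \<Gamma> \<in> hom (artin_group \<Gamma>) (coxeter_group \<Gamma>)"
proof (rule homI)
  note A = artin_presentation[OF \<Gamma>] and W = coxeter_presentation[OF \<Gamma>]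
  fix a assume "a \<in> carrier (artin_group \<Gamma>)"
  then obtain u where u: "u \<in> signed_words (verts \<Gamma>)" "a = artin_class \<Gamma> u"
    by (auto simp: artin_group_def presentation.carrier_eq[OF A])
  then show "artin_to_coxeter \<Gamma> a \<in> carrier (coxeter_group \<Gamma>)"
    by (simp add: artin_to_coxeter_class[OF \<Gamma>] coxeter_group_def presentation.carrier_eq[OF W])
  fix b assume "b \<in> carrier (artin_group \<Gamma>)"
  then obtain v where v: "v \<in> signed_words (verts \<Gamma>)" "b = artin_class \<Gamma> v"
    by (auto simp: artin_group_def presentation.carrier_eq[OF A])
  show "artin_to_coxeter \<Gamma> (a \<otimes>\<^bsub>artin_group \<Gamma>\<^esub> b) =
      artin_to_coxeter \<Gamma> a \<otimes>\<^bsub>coxeter_group \<Gamma>\<^esub> artin_to_coxeter \<Gamma> b"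
    using u v
    by (simp add: artin_to_coxeter_class[OF \<Gamma>] artin_group_def coxeter_group_def
        presentation.mult_word_class[OF A] presentation.mult_word_class[OF W]
        presentation.signed_words_append[OF A])
qed

lemma artin_to_coxeter_surj:
  assumes \<Gamma>: "wf_labelled_graph \<Gamma>"
  shows "artin_to_coxeter \<Gamma> ` carrier (artin_group \<Gamma>) = carrier (coxeter_group \<Gamma>)"
  by (simp add: artin_group_def coxeter_group_def image_image artin_to_coxeter_class[OF \<Gamma>]
      presentation.carrier_eq[OF artin_presentation[OF \<Gamma>]]
      presentation.carrier_eq[OF coxeter_presentation[OF \<Gamma>]] cong: image_cong)

section \<open>The map on words\<close>

definition word_prod :: "('a, 'b) monoid_scheme \<Rightarrow> 'a list \<Rightarrow> 'a" where
  "word_prod G ws = foldr (mult G) ws \<one>\<^bsub>G\<^esub>"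

text \<open>The generators of a Coxeter group are involutions, so positive words suffice.\<close>

definition cox_length :: "'v labelled_graph \<Rightarrow> 'v signed_word set \<Rightarrow> nat" where
  "cox_length \<Gamma> w =
     (LEAST n. \<exists>ws. set ws \<subseteq> cox_gen \<Gamma> ` verts \<Gamma> \<and> length ws = n \<and> w = word_prod (coxeter_group \<Gamma>) ws)"

definition coset_minimal :: "'v labelled_graph \<Rightarrow> 'v set \<Rightarrow> 'v signed_word set \<Rightarrow> bool" where
  "coset_minimal \<Gamma> X w \<longleftrightarrow>
     w \<in> carrier (coxeter_group \<Gamma>) \<and>
     (\<forall>u \<in> cox_subgroup \<Gamma> X #>\<^bsub>coxeter_group \<Gamma>\<^esub> w. cox_length \<Gamma> w \<le> cox_length \<Gamma> u)"

definition min_part :: "'v labelled_graph \<Rightarrow> 'v set \<Rightarrow> 'v signed_word set \<Rightarrow> 'v signed_word set" where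
  "min_part \<Gamma> X u =
     (THE w. coset_minimal \<Gamma> X w \<and> (\<exists>v\<in>cox_subgroup \<Gamma> X. u = v \<otimes>\<^bsub>coxeter_group \<Gamma>\<^esub> w))"

definition prefix_elt :: "'v labelled_graph \<Rightarrow> 'v signed_word \<Rightarrow> nat \<Rightarrow> 'v signed_word set" where
  "prefix_elt \<Gamma> \<alpha> i = word_prod (coxeter_group \<Gamma>) (map (\<lambda>(z, \<epsilon>). cox_gen \<Gamma> z) (take i \<alpha>))"

text \<open>Letters are counted from 0 and prefixes by their length: the letter \<open>\<alpha> ! i\<close> lies between
  the prefixes of length \<open>i\<close> and \<open>Suc i\<close>.\<close>

definition letter_conj :: "'v labelled_graph \<Rightarrow> 'v set \<Rightarrow> 'v signed_word \<Rightarrow> nat \<Rightarrow> 'v signed_word set" where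
  "letter_conj \<Gamma> X \<alpha> i =
     (let (z, \<epsilon>) = \<alpha> ! i;
          w = min_part \<Gamma> X (prefix_elt \<Gamma> \<alpha> (if \<epsilon> then i else Suc i))
      in w \<otimes>\<^bsub>coxeter_group \<Gamma>\<^esub> cox_gen \<Gamma> z \<otimes>\<^bsub>coxeter_group \<Gamma>\<^esub> inv\<^bsub>coxeter_group \<Gamma>\<^esub> w)"

definition pi_hat_letter :: "'v labelled_graph \<Rightarrow> 'v set \<Rightarrow> 'v signed_word \<Rightarrow> nat \<Rightarrow> 'v signed_word" where
  "pi_hat_letter \<Gamma> X \<alpha> i =
     (if letter_conj \<Gamma> X \<alpha> i \<in> cox_gen \<Gamma> ` X
      then [(THE x. x \<in> X \<and> letter_conj \<Gamma> X \<alpha> i = cox_gen \<Gamma> x, snd (\<alpha> ! i))]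
      else [])"

definition pi_hat :: "'v labelled_graph \<Rightarrow> 'v set \<Rightarrow> 'v signed_word \<Rightarrow> 'v signed_word" where
  "pi_hat \<Gamma> X \<alpha> = concat (map (pi_hat_letter \<Gamma> X \<alpha>) [0..<length \<alpha>])"

end

theory Submission
  imports Complex_Main Defs "HOL-Library.Sublist"
begin

text \<open>
  The word \<open>\<pi>\<close>-hat of \<open>\<alpha>\<close> is the output of a transducer. Its states are the cosets \<open>W\<^sub>X u\<close>, each
  represented by its minimal element \<open>w\<close>. Reading the letter \<open>\<sigma>\<^sub>z\<close> or \<open>\<sigma>\<^sub>z\<^sup>-\<^sup>1\<close> either moves to the
  minimal element \<open>w s\<^sub>z\<close> in silence, or, if \<open>w s\<^sub>z w\<^sup>-\<^sup>1\<close> is a generator \<open>s\<^sub>x\<close> with \<open>x \<in> X\<close>, stays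
  at \<open>w\<close> and prints \<open>x\<close> with the sign of the letter that was read. That there is no third
  possibility is Deodhar's lemma (\<open>minimal_mult_gen\<close>). In particular the printed generator is the
  same whether it is computed from the state before or after the letter, which makes the
  cancellation of \<open>\<sigma>\<^sub>z \<sigma>\<^sub>z\<^sup>-\<^sup>1\<close> harmless, and a transducer maps a congruence generated by relations
  into a congruence as soon as each relation, read from each state, is printed as an equality.

  So everything rests on reading the two sides \<open>Prod(x,y,m)\<close> and \<open>Prod(y,x,m)\<close> of one relation
  from a state \<open>u\<close> (\<open>trace_dihedral\<close>). Let \<open>w\<^sub>0\<close> be the shortest element of the double coset
  \<open>W\<^sub>X u W\<^sub>Y\<close> with \<open>Y = {x,y}\<close>. Every generator printed while letters of \<open>Y\<close> move through the
  states of this double coset is already printed at \<open>w\<^sub>0\<close>, so it is one of \<open>w\<^sub>0 s\<^sub>x w\<^sub>0\<^sup>-\<^sup>1\<close> and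
  \<open>w\<^sub>0 s\<^sub>y w\<^sub>0\<^sup>-\<^sup>1\<close> (\<open>parabolic_loops\<close>). If both are generators \<open>s\<^sub>x\<^sub>'\<close> and \<open>s\<^sub>y\<^sub>'\<close> of \<open>W\<^sub>X\<close>, then there is
  a single state, and the output is the alternating word in \<open>x'\<close> and \<open>y'\<close> of length \<open>m\<close>.
  Otherwise at most one letter can be printed. The reflections attached to the printed word form
  a sublist of those attached to the word that was read (\<open>trace_inversions_subseq\<close>), which are
  distinct, so this letter occurs at most once; as both outputs have the same value in \<open>W\<close>,
  they coincide.

  In the first case one still needs that \<open>\<Gamma>\<close> has an edge \<open>{x',y'}\<close> with the label \<open>m\<close>. The products
  \<open>s\<^sub>x s\<^sub>y\<close> and \<open>s\<^sub>x\<^sub>' s\<^sub>y\<^sub>'\<close> are conjugate, so it is enough that the label of an edge is the exact order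
  of the product of its two generators, and that this order is infinite for two vertices without an
  edge. The geometric representation shows this (\<open>edge_power_less_label\<close>, \<open>nonedge_power\<close>);
  it also separates the generators. The theory of lengths and minimal elements rests on the
  deletion condition, which follows from the fact that the parity with which a reflection occurs
  among the inversions of a word depends only on the value of the word (\<open>parity_pres_rel\<close>).

  Finally, a word over \<open>X\<close> never leaves the state \<open>1\<close> and is printed letter by letter, and a word
  that represents an element of the colored Artin group returns to the state \<open>1\<close>, after which the
  next word is read as if from the start.
\<close>

section \<open>Words and conjugation in a group\<close>

definition conjugate :: "('a, 'b) monoid_scheme \<Rightarrow> 'a \<Rightarrow> 'a \<Rightarrow> 'a" where
  "conjugate G g h = g \<otimes>\<^bsub>G\<^esub> h \<otimes>\<^bsub>G\<^esub> inv\<^bsub>G\<^esub> g"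

text \<open>The \<open>i\<close>-th entry for the word \<open>s\<^sub>1 \<dots> s\<^sub>n\<close> is \<open>(s\<^sub>1 \<dots> s\<^sub>i\<^sub>-\<^sub>1) s\<^sub>i (s\<^sub>1 \<dots> s\<^sub>i\<^sub>-\<^sub>1)\<^sup>-\<^sup>1\<close>, the reflection
  that deletes the letter \<open>s\<^sub>i\<close> of a word in involutions when it multiplies the word from the left.\<close>
fun inversions :: "('a, 'b) monoid_scheme \<Rightarrow> 'a list \<Rightarrow> 'a list" where
  "inversions G [] = []"
| "inversions G (s # ws) = s # map (conjugate G s) (inversions G ws)"

definition word_length :: "('a, 'b) monoid_scheme \<Rightarrow> 'a set \<Rightarrow> 'a \<Rightarrow> nat" where
  "word_length G S w = (LEAST n. \<exists>ws. set ws \<subseteq> S \<and> length ws = n \<and> w = word_prod G ws)"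

definition minimal_in_coset :: "('a, 'b) monoid_scheme \<Rightarrow> 'a set \<Rightarrow> 'a set \<Rightarrow> 'a \<Rightarrow> bool" where
  "minimal_in_coset G S X w \<longleftrightarrow> w \<in> carrier G \<and>
     (\<forall>u \<in> generate G X #>\<^bsub>G\<^esub> w. word_length G S w \<le> word_length G S u)"

definition minimal_rep :: "('a, 'b) monoid_scheme \<Rightarrow> 'a set \<Rightarrow> 'a set \<Rightarrow> 'a \<Rightarrow> 'a" where
  "minimal_rep G S X u =
     (THE w. minimal_in_coset G S X w \<and> (\<exists>v\<in>generate G X. u = v \<otimes>\<^bsub>G\<^esub> w))"

lemma word_prod_simps [simp]:
  "word_prod G [] = \<one>\<^bsub>G\<^esub>"
  "word_prod G (s # ws) = s \<otimes>\<^bsub>G\<^esub> word_prod G ws"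
  by (simp_all add: word_prod_def)

lemma length_inversions [simp]: "length (inversions G ws) = length ws"
  by (induction ws) auto

context group
begin

lemma word_prod_closed [simp]: "set ws \<subseteq> carrier G \<Longrightarrow> word_prod G ws \<in> carrier G"
  by (induction ws) auto

lemma word_prod_append:
  "set us \<subseteq> carrier G \<Longrightarrow> set ws \<subseteq> carrier G \<Longrightarrow>
     word_prod G (us @ ws) = word_prod G us \<otimes> word_prod G ws"
  by (induction us) (auto simp: m_assoc)

lemma inv_word_prod:
  "set ws \<subseteq> carrier G \<Longrightarrow> (\<And>s. s \<in> set ws \<Longrightarrow> s \<otimes> s = \<one>) \<Longrightarrow>
     inv (word_prod G ws) = word_prod G (rev ws)"
  by (induction ws) (auto simp: inv_mult_group word_prod_append inv_equality)

lemma word_prod_in_generate: "set ws \<subseteq> X \<Longrightarrow> word_prod G ws \<in> generate G X"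
  by (induction ws) (auto intro: generate.intros)

lemma cancel_left [simp]:
  assumes "a \<in> carrier G" "b \<in> carrier G"
  shows "inv a \<otimes> (a \<otimes> b) = b" "a \<otimes> (inv a \<otimes> b) = b"
  using assms by (simp_all flip: m_assoc)

lemma conjugate_closed [simp]:
  "g \<in> carrier G \<Longrightarrow> h \<in> carrier G \<Longrightarrow> conjugate G g h \<in> carrier G"
  by (simp add: conjugate_def)

lemma conjugate_comp:
  "a \<in> carrier G \<Longrightarrow> b \<in> carrier G \<Longrightarrow> h \<in> carrier G \<Longrightarrow>
     conjugate G a (conjugate G b h) = conjugate G (a \<otimes> b) h"
  by (simp add: conjugate_def m_assoc inv_mult_group)

lemma conjugate_mult:
  "g \<in> carrier G \<Longrightarrow> a \<in> carrier G \<Longrightarrow> b \<in> carrier G \<Longrightarrow>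
     conjugate G g (a \<otimes> b) = conjugate G g a \<otimes> conjugate G g b"
  by (simp add: conjugate_def m_assoc)

lemma conjugate_one [simp]: "h \<in> carrier G \<Longrightarrow> conjugate G \<one> h = h"
  "g \<in> carrier G \<Longrightarrow> conjugate G g \<one> = \<one>"
  by (simp_all add: conjugate_def)

lemma conjugate_self [simp]: "g \<in> carrier G \<Longrightarrow> conjugate G g g = g"
  by (simp add: conjugate_def m_assoc)

lemma conjugate_inv_cancel [simp]:
  "g \<in> carrier G \<Longrightarrow> h \<in> carrier G \<Longrightarrow> conjugate G (inv g) (conjugate G g h) = h"
  "g \<in> carrier G \<Longrightarrow> h \<in> carrier G \<Longrightarrow> conjugate G g (conjugate G (inv g) h) = h"
  by (simp_all add: conjugate_comp)

lemma conjugate_eq_iff [simp]: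
  assumes "g \<in> carrier G" "a \<in> carrier G" "b \<in> carrier G"
  shows "conjugate G g a = conjugate G g b \<longleftrightarrow> a = b"
  using assms by (metis conjugate_inv_cancel(1))

lemma conjugate_mult_right:
  "g \<in> carrier G \<Longrightarrow> h \<in> carrier G \<Longrightarrow> conjugate G g h \<otimes> g = g \<otimes> h"
  by (simp add: conjugate_def m_assoc)

lemma conjugate_eqI:
  "g \<in> carrier G \<Longrightarrow> h \<in> carrier G \<Longrightarrow> t \<in> carrier G \<Longrightarrow> t \<otimes> g = g \<otimes> h \<Longrightarrow> conjugate G g h = t"
  unfolding conjugate_def by (metis inv_solve_right m_closed)

lemma conjugate_word_prod:
  "g \<in> carrier G \<Longrightarrow> set ws \<subseteq> carrier G \<Longrightarrow>
     conjugate G g (word_prod G ws) = word_prod G (map (conjugate G g) ws)"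
  by (induction ws) (auto simp: conjugate_mult)

lemma inversions_closed: "set ws \<subseteq> carrier G \<Longrightarrow> set (inversions G ws) \<subseteq> carrier G"
  by (induction ws) auto

lemma map_conjugate_comp:
  "a \<in> carrier G \<Longrightarrow> b \<in> carrier G \<Longrightarrow> set L \<subseteq> carrier G \<Longrightarrow>
     map (conjugate G a) (map (conjugate G b) L) = map (conjugate G (a \<otimes> b)) L"
  by (auto simp: conjugate_comp)

lemma count_list_map_conjugate:
  "g \<in> carrier G \<Longrightarrow> t \<in> carrier G \<Longrightarrow> set L \<subseteq> carrier G \<Longrightarrow>
     count_list (map (conjugate G g) L) t = count_list L (conjugate G (inv g) t)"
  by (induction L) auto

lemma inversions_append:
  "set us \<subseteq> carrier G \<Longrightarrow> set ws \<subseteq> carrier G \<Longrightarrow>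
     inversions G (us @ ws) = inversions G us @ map (conjugate G (word_prod G us)) (inversions G ws)"
proof (induction us)
  case Nil
  then show ?case using inversions_closed[of ws] by (auto intro!: map_idI[symmetric])
next
  case (Cons s us)
  then show ?case
    using inversions_closed[of ws] by (simp add: map_conjugate_comp del: map_map)
qed

end

section \<open>Length and the deletion condition\<close>

text \<open>The last assumption is what remains of Bourbaki's action of a Coxeter group on signed
  reflections; it is the only one that distinguishes Coxeter groups from other groups generated by
  involutions, and it is easy to check on a presentation.\<close>
locale parity_group = group G for G (structure) +
  fixes S :: "'a set"
  assumes gens_closed: "S \<subseteq> carrier G"
    and gens_square: "s \<in> S \<Longrightarrow> s \<otimes> s = \<one>"
    and gens_generate: "generate G S = carrier G"
    and inversions_parity:
      "set us \<subseteq> S \<Longrightarrow> set ws \<subseteq> S \<Longrightarrow> word_prod G us = word_prod G ws \<Longrightarrow>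
       odd (count_list (inversions G us) t) = odd (count_list (inversions G ws) t)"
begin

abbreviation "len \<equiv> word_length G S"
abbreviation "minimal \<equiv> minimal_in_coset G S"
abbreviation "rep \<equiv> minimal_rep G S"

lemma gen_closed [simp]: "s \<in> S \<Longrightarrow> s \<in> carrier G"
  using gens_closed by auto

lemma gen_inv: "s \<in> S \<Longrightarrow> inv s = s"
  by (simp add: gens_square inv_equality)

lemma wp_closed [simp]: "set ws \<subseteq> S \<Longrightarrow> word_prod G ws \<in> carrier G"
  using gens_closed by auto

lemma wp_append: "set us \<subseteq> S \<Longrightarrow> set ws \<subseteq> S \<Longrightarrow>
     word_prod G (us @ ws) = word_prod G us \<otimes> word_prod G ws"
  using gens_closed by (auto intro!: word_prod_append)

lemma inv_wp: "set ws \<subseteq> S \<Longrightarrow> inv (word_prod G ws) = word_prod G (rev ws)"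
  by (rule inv_word_prod) (use gens_closed gens_square in auto)

lemma generate_wordE:
  assumes "X \<subseteq> S" "v \<in> generate G X"
  obtains ws where "set ws \<subseteq> X" "word_prod G ws = v"
proof -
  have "\<exists>ws. set ws \<subseteq> X \<and> word_prod G ws = v"
    using assms(2)
  proof induction
    case one
    show ?case by (rule exI[of _ "[]"]) simp
  next
    case (incl h)
    then show ?case using assms(1) by (intro exI[of _ "[h]"]) auto
  next
    case (inv h)
    then show ?case using assms(1) by (intro exI[of _ "[h]"]) (auto simp: gen_inv subset_iff)
  next
    case (eng h1 h2)
    then obtain us ws where "set us \<subseteq> X" "word_prod G us = h1" "set ws \<subseteq> X" "word_prod G ws = h2"
      by blast
    then show ?case using assms(1)
      by (intro exI[of _ "us @ ws"]) (auto simp: wp_append)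
  qed
  then show ?thesis using that by blast
qed

lemma len_le: "set ws \<subseteq> S \<Longrightarrow> len (word_prod G ws) \<le> length ws"
  unfolding word_length_def by (rule Least_le) blast

lemma reduced_wordE:
  assumes "w \<in> carrier G"
  obtains ws where "set ws \<subseteq> S" "word_prod G ws = w" "length ws = len w"
proof -
  obtain ws where "set ws \<subseteq> S" "word_prod G ws = w"
    using generate_wordE[of S w] assms gens_generate by auto
  then have "\<exists>n ws. set ws \<subseteq> S \<and> length ws = n \<and> w = word_prod G ws" by blast
  from LeastI_ex[OF this] show ?thesis
    using that unfolding word_length_def by blast
qed

text \<open>If \<open>p s p\<^sup>-\<^sup>1 = (p s q) t (p s q)\<^sup>-\<^sup>1\<close>, where \<open>p\<close> and \<open>q\<close> are the values of \<open>a\<close> and \<open>b\<close>, then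
  \<open>s q t = q\<close>.\<close>
lemma equal_inversions_delete:
  assumes "set (a @ s # b @ t # c) \<subseteq> S"
    and eq: "inversions G (a @ s # b @ t # c) ! length a
      = inversions G (a @ s # b @ t # c) ! (length a + Suc (length b))"
  shows "word_prod G (a @ s # b @ t # c) = word_prod G (a @ b @ c)"
proof -
  let ?p = "word_prod G a" and ?q = "word_prod G b" and ?r = "word_prod G c"
  have cl: "?p \<in> carrier G" "?q \<in> carrier G" "?r \<in> carrier G" "s \<in> carrier G" "t \<in> carrier G"
    and cls: "set a \<subseteq> carrier G" "set b \<subseteq> carrier G" "set c \<subseteq> carrier G"
    using assms(1) gens_closed by auto
  have "conjugate G ?p s = conjugate G ?p (conjugate G s (conjugate G ?q t))"
    using eq cl cls by (simp add: inversions_append nth_append)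
  then have "s = conjugate G s (conjugate G ?q t)"
    using cl by simp
  then have "s \<otimes> s = s \<otimes> conjugate G ?q t"
    using cl by (metis conjugate_closed conjugate_mult_right)
  then have "s = conjugate G ?q t"
    using cl by simp
  then have "s \<otimes> ?q = ?q \<otimes> t"
    using cl by (metis conjugate_mult_right)
  then have "s \<otimes> (?q \<otimes> (t \<otimes> ?r)) = ?q \<otimes> (t \<otimes> (t \<otimes> ?r))"
    using cl by (simp flip: m_assoc)
  also have "\<dots> = ?q \<otimes> ?r"
    using cl gens_square[of t] assms(1) by (simp flip: m_assoc[of t])
  finally show ?thesis
    using cl cls by (simp add: word_prod_append)
qed

lemma delete_repeated_inversion:
  assumes "set ws \<subseteq> S" "\<not> distinct (inversions G ws)"
  shows "\<exists>a s b t c. ws = a @ s # b @ t # c \<and> word_prod G ws = word_prod G (a @ b @ c)"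
proof -
  obtain i j where ij: "i < j" "j < length ws" "inversions G ws ! i = inversions G ws ! j"
    using assms(2) by (metis distinct_conv_nth length_inversions linorder_neq_iff)
  define a where "a = take i ws"
  define b where "b = take (j - Suc i) (drop (Suc i) ws)"
  define c where "c = drop (Suc j) ws"
  have "ws = a @ ws ! i # drop (Suc i) ws"
    using ij by (simp add: a_def id_take_nth_drop)
  also have "drop (Suc i) ws = b @ ws ! j # c"
    using ij id_take_nth_drop[of "j - Suc i" "drop (Suc i) ws"] by (simp add: b_def c_def)
  finally have ws: "ws = a @ ws ! i # b @ ws ! j # c" .
  have "length a = i" "length a + Suc (length b) = j"
    using ij by (simp_all add: a_def b_def)
  then show ?thesis
    using equal_inversions_delete[of a "ws ! i" b "ws ! j" c] ws ij assms(1) by metis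
qed

text \<open>A word with pairwise distinct inversions is reduced: each of them occurs an odd number of times,
  hence occurs in every other word for the same element, which is therefore at least as long. So a
  word that is not reduced has a repeated inversion.\<close>
lemma deletion:
  assumes ws: "set ws \<subseteq> S" and nonred: "len (word_prod G ws) < length ws"
  shows "\<exists>a s b t c. ws = a @ s # b @ t # c \<and> word_prod G ws = word_prod G (a @ b @ c)"
proof (rule delete_repeated_inversion[OF ws], rule notI)
  assume dist: "distinct (inversions G ws)"
  obtain us where us: "set us \<subseteq> S" "word_prod G us = word_prod G ws"
      "length us = len (word_prod G ws)"
    using reduced_wordE[of "word_prod G ws"] ws by auto
  have "set (inversions G ws) \<subseteq> set (inversions G us)"
  proof
    fix t assume "t \<in> set (inversions G ws)"
    then have "count_list (inversions G ws) t = 1"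
      using dist by (induction "inversions G ws") (auto simp: count_list_eq_length_filter
          distinct_length_filter Int_insert_right)
    then have "odd (count_list (inversions G us) t)"
      using inversions_parity[OF us(1) ws us(2), of t] by simp
    then show "t \<in> set (inversions G us)"
      by (metis count_notin even_zero)
  qed
  then have "card (set (inversions G ws)) \<le> card (set (inversions G us))"
    by (simp add: card_mono)
  also have "\<dots> \<le> length us"
    using card_length[of "inversions G us"] by simp
  finally show False
    using nonred us(3) distinct_card[OF dist] by simp
qed

text \<open>Deletion removes two letters at a time.\<close>
lemma even_len: "set ws \<subseteq> S \<Longrightarrow> even (len (word_prod G ws)) = even (length ws)"
proof (induction "length ws" arbitrary: ws rule: less_induct)
  case less
  show ?case
  proof (cases "len (word_prod G ws) = length ws")
    case False
    then have "len (word_prod G ws) < length ws"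
      using len_le[OF less.prems] by simp
    then obtain a s b t c where eq: "ws = a @ s # b @ t # c"
        "word_prod G ws = word_prod G (a @ b @ c)"
      using deletion[OF less.prems] by blast
    have "even (len (word_prod G (a @ b @ c))) = even (length (a @ b @ c))"
      using less.prems eq(1) by (intro less.hyps) auto
    then show ?thesis using eq by simp
  qed simp
qed

lemma len_gen: "s \<in> S \<Longrightarrow> len s = 1"
  using even_len[of "[s]"] len_le[of "[s]"] by (cases "len s") auto

lemma len_one: "len \<one> = 0"
  using len_le[of "[]"] by simp

lemma len_zeroD: "w \<in> carrier G \<Longrightarrow> len w = 0 \<Longrightarrow> w = \<one>"
  by (erule reduced_wordE[of w]) simp

lemma len_mult_gen:
  assumes "w \<in> carrier G" "s \<in> S"
  shows "len (w \<otimes> s) = Suc (len w) \<or> Suc (len (w \<otimes> s)) = len w"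
proof -
  have up: "len (w \<otimes> s) \<le> Suc (len w)" and par: "even (len (w \<otimes> s)) \<noteq> even (len w)"
    if w: "w \<in> carrier G" for w
  proof -
    obtain ws where ws: "set ws \<subseteq> S" "word_prod G ws = w" "length ws = len w"
      using reduced_wordE[OF w] by blast
    have "w \<otimes> s = word_prod G (ws @ [s])" using ws assms by (simp add: wp_append)
    then show "len (w \<otimes> s) \<le> Suc (len w)" "even (len (w \<otimes> s)) \<noteq> even (len w)"
      using len_le[of "ws @ [s]"] even_len[of "ws @ [s]"] ws assms(2) by auto
  qed
  have "w \<otimes> s \<otimes> s = w" using assms by (simp add: m_assoc gens_square)
  then have "len w \<le> Suc (len (w \<otimes> s))" using up[of "w \<otimes> s"] assms by simp
  moreover have "len (w \<otimes> s) \<noteq> len w" using par[OF assms(1)] by auto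
  ultimately show ?thesis using up[OF assms(1)] by linarith
qed

lemma len_inv:
  assumes "w \<in> carrier G"
  shows "len (inv w) = len w"
proof -
  have le: "len (inv w) \<le> len w" if "w \<in> carrier G" for w
    by (rule reduced_wordE[OF that]) (metis inv_wp len_le length_rev set_rev)
  show ?thesis using le[of w] le[of "inv w"] assms by simp
qed

section \<open>Minimal elements of the cosets of a parabolic subgroup\<close>

text \<open>Deletion does not introduce new letters, so a word over \<open>X\<close> of minimal length among the words
  over \<open>X\<close> is reduced for \<open>S\<close> as well.\<close>
lemma reduced_word_parabolicE:
  assumes X: "X \<subseteq> S" and v: "v \<in> generate G X"
  obtains ws where "set ws \<subseteq> X" "word_prod G ws = v" "length ws = len v"
proof -
  let ?P = "\<lambda>ws. set ws \<subseteq> X \<and> word_prod G ws = v"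
  obtain ws0 where "?P ws0" using generate_wordE[OF X v] by blast
  then obtain ws where ws: "?P ws" and least: "\<And>us. ?P us \<Longrightarrow> length ws \<le> length us"
    using ex_has_least_nat[of ?P ws0 length] by blast
  have "length ws = len v"
  proof (rule ccontr)
    assume "length ws \<noteq> len v"
    then have "len (word_prod G ws) < length ws"
      using len_le[of ws] ws X by fastforce
    then obtain a s b t c where "ws = a @ s # b @ t # c"
        "word_prod G ws = word_prod G (a @ b @ c)"
      using deletion[of ws] ws X by blast
    then show False using least[of "a @ b @ c"] ws by auto
  qed
  then show ?thesis using that ws by blast
qed

lemma parabolic_closed: "X \<subseteq> S \<Longrightarrow> v \<in> generate G X \<Longrightarrow> v \<in> carrier G"
  using generate_in_carrier[of X v] gens_closed by blast

lemma subgroup_parabolic: "X \<subseteq> S \<Longrightarrow> subgroup (generate G X) G"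
  using generate_is_subgroup[of X] gens_closed by blast

lemma minimal_iff:
  "minimal X w \<longleftrightarrow> w \<in> carrier G \<and> (\<forall>v\<in>generate G X. len w \<le> len (v \<otimes> w))"
  by (auto simp: minimal_in_coset_def r_coset_def)

text \<open>Join reduced words of \<open>v\<close> and \<open>w\<close>. If the result were not reduced, two letters could be deleted:
  both from \<open>v\<close> contradicts that the word of \<open>v\<close> is reduced, and a deletion that touches
  \<open>w\<close> leaves a shorter element of its coset.\<close>
lemma minimal_len_add:
  assumes X: "X \<subseteq> S" and w: "minimal X w" and v: "v \<in> generate G X"
  shows "len (v \<otimes> w) = len v + len w"
proof -
  obtain us where us: "set us \<subseteq> X" "word_prod G us = v" "length us = len v"
    using reduced_word_parabolicE[OF X v] by blast
  have wcl: "w \<in> carrier G" using w by (simp add: minimal_iff)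
  obtain ws where ws: "set ws \<subseteq> S" "word_prod G ws = w" "length ws = len w"
    using reduced_wordE[OF wcl] by blast
  have usS: "set us \<subseteq> S" using us X by auto
  have vw: "v \<otimes> w = word_prod G (us @ ws)"
    using us usS ws by (simp add: wp_append)
  \<comment> \<open>A factorisation of \<open>v w\<close> with a first factor in the parabolic subgroup and a shorter second
      factor would give a shorter element of the coset of \<open>w\<close>.\<close>
  have short: "length ws \<le> length ws'"
    if "set us' \<subseteq> X" "set ws' \<subseteq> S" "v \<otimes> w = word_prod G (us' @ ws')" for us' ws'
  proof -
    let ?v' = "word_prod G us'"
    have v': "?v' \<in> generate G X" using word_prod_in_generate that by blast
    have cl: "?v' \<in> carrier G" "v \<in> carrier G" using parabolic_closed[OF X] v' v by auto
    have "v \<otimes> w = ?v' \<otimes> word_prod G ws'"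
      using that X by (simp add: wp_append subset_trans[OF that(1) X])
    then have "word_prod G ws' = (inv ?v' \<otimes> v) \<otimes> w"
      using cl wcl that(2) by (simp add: m_assoc)
    moreover have "inv ?v' \<otimes> v \<in> generate G X"
      using subgroup_parabolic[OF X] v v' by (simp add: subgroup.m_closed subgroup.m_inv_closed)
    ultimately have "len w \<le> len (word_prod G ws')" using w by (simp add: minimal_iff)
    then show ?thesis using len_le[OF that(2)] ws(3) by simp
  qed
  have "\<not> len (v \<otimes> w) < length (us @ ws)"
  proof
    assume "len (v \<otimes> w) < length (us @ ws)"
    then obtain a s b t c where eq: "us @ ws = a @ s # b @ t # c"
        "v \<otimes> w = word_prod G (a @ b @ c)"
      using deletion[of "us @ ws"] usS ws vw by auto
    consider d where "us = a @ s # b @ t # d" "c = d @ ws"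
      | d e where "us = a @ s # d" "b = d @ e" "ws = e @ t # c"
      | d where "a = us @ d" "ws = d @ s # b @ t # c"
      using eq(1) by (auto simp: append_eq_append_conv2 append_eq_Cons_conv Cons_eq_append_conv)
    then show False
    proof cases
      case 1
      then have "v \<otimes> w = word_prod G (a @ b @ d) \<otimes> w"
        using eq(2) usS ws wcl by (simp add: wp_append m_assoc)
      then have "v = word_prod G (a @ b @ d)"
        using 1 usS wcl us(2) wp_closed[of "a @ b @ d"] wp_closed[of us] by simp
      then show False using len_le[of "a @ b @ d"] usS 1 us(3) by simp
    next
      case 2
      then show False using short[of "a @ d" "e @ c"] eq(2) us(1) ws(1) by simp
    next
      case 3
      then show False using short[of us "d @ b @ c"] eq(2) us(1) ws(1) by simp
    qed
  qed
  then show ?thesis using len_le[of "us @ ws"] usS ws us vw by auto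
qed

lemma minimal_unique:
  assumes X: "X \<subseteq> S" and "minimal X w" "minimal X w'" "v \<in> generate G X" "w' = v \<otimes> w"
  shows "w' = w"
proof -
  have cl: "v \<in> carrier G" "w \<in> carrier G"
    using assms parabolic_closed by (auto simp: minimal_iff)
  have "w = inv v \<otimes> w'" using assms(5) cl by simp
  moreover have "inv v \<in> generate G X"
    using subgroup.m_inv_closed[OF subgroup_parabolic[OF X] assms(4)] .
  ultimately have "len w' \<le> len w" using assms(3) by (simp add: minimal_iff)
  then have "len v = 0" using minimal_len_add[OF X assms(2,4)] assms(5) by simp
  then show ?thesis using len_zeroD cl assms(5) by simp
qed

lemma minimal_exists:
  assumes X: "X \<subseteq> S" and u: "u \<in> carrier G"
  shows "\<exists>w v. minimal X w \<and> v \<in> generate G X \<and> u = v \<otimes> w"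
proof -
  obtain v where v: "v \<in> generate G X"
    and least: "\<And>v'. v' \<in> generate G X \<Longrightarrow> len (v \<otimes> u) \<le> len (v' \<otimes> u)"
    using ex_has_least_nat[of "\<lambda>v. v \<in> generate G X" \<one> "\<lambda>v. len (v \<otimes> u)"]
      generate.one by blast
  have cl: "v \<in> carrier G" using parabolic_closed[OF X v] .
  have sg: "subgroup (generate G X) G" using subgroup_parabolic[OF X] .
  have "minimal X (v \<otimes> u)"
    using least subgroup.m_closed[OF sg _ v] cl u parabolic_closed[OF X]
    by (auto simp: minimal_iff simp flip: m_assoc)
  moreover have "inv v \<in> generate G X" using subgroup.m_inv_closed[OF sg v] .
  moreover have "u = inv v \<otimes> (v \<otimes> u)" using cl u by simp
  ultimately show ?thesis by blast
qed

lemma rep_eqI: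
  assumes X: "X \<subseteq> S" and w: "minimal X w" "v \<in> generate G X" "u = v \<otimes> w"
  shows "rep X u = w"
  unfolding minimal_rep_def
proof (rule the_equality)
  fix w' assume "minimal X w' \<and> (\<exists>v\<in>generate G X. u = v \<otimes> w')"
  then obtain v' where v': "minimal X w'" "v' \<in> generate G X" "u = v' \<otimes> w'" by blast
  have sg: "subgroup (generate G X) G" using subgroup_parabolic[OF X] .
  have cl: "v \<in> carrier G" "v' \<in> carrier G" "w \<in> carrier G" "w' \<in> carrier G"
    using w v' parabolic_closed[OF X] by (auto simp: minimal_iff)
  have "w' = inv v' \<otimes> (v \<otimes> w)" using cl v'(3) w(3) by simp
  then have "w' = (inv v' \<otimes> v) \<otimes> w" using cl by (simp add: m_assoc)
  then show "w' = w"
    by (rule minimal_unique[OF X w(1) v'(1)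
          subgroup.m_closed[OF sg subgroup.m_inv_closed[OF sg v'(2)] w(2)]])
qed (use w in blast)

lemma repE:
  assumes "X \<subseteq> S" "u \<in> carrier G"
  obtains v where "minimal X (rep X u)" "v \<in> generate G X" "u = v \<otimes> rep X u"
    "rep X u \<in> carrier G" "v \<in> carrier G"
  using minimal_exists[OF assms] rep_eqI[OF assms(1)] parabolic_closed[OF assms(1)]
  by (metis minimal_iff)

lemma rep_closed [simp]: "X \<subseteq> S \<Longrightarrow> u \<in> carrier G \<Longrightarrow> rep X u \<in> carrier G"
  by (rule repE)

lemma minimal_one: "minimal X \<one>"
  by (auto simp: minimal_iff len_one)

lemma rep_parabolic: "X \<subseteq> S \<Longrightarrow> v \<in> generate G X \<Longrightarrow> rep X v = \<one>"
  by (rule rep_eqI[OF _ minimal_one]) (auto dest: parabolic_closed)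

lemma rep_mult_left:
  assumes X: "X \<subseteq> S" and "v \<in> generate G X" "u \<in> carrier G"
  shows "rep X (v \<otimes> u) = rep X u"
proof -
  obtain v' where v': "minimal X (rep X u)" "v' \<in> generate G X" "u = v' \<otimes> rep X u"
    "rep X u \<in> carrier G" "v' \<in> carrier G" using repE[OF X assms(3)] .
  have "v \<otimes> u = (v \<otimes> v') \<otimes> rep X u"
    using v' assms parabolic_closed[OF X assms(2)] by (metis m_assoc)
  then show ?thesis using rep_eqI[OF X v'(1) generate.eng[OF assms(2) v'(2)]] by simp
qed

lemma rep_rep:
  assumes X: "X \<subseteq> S" and u: "u \<in> carrier G" and s: "s \<in> carrier G"
  shows "rep X (rep X u \<otimes> s) = rep X (u \<otimes> s)"
proof -
  obtain v where v: "v \<in> generate G X" "u = v \<otimes> rep X u" "rep X u \<in> carrier G" "v \<in> carrier G"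
    using repE[OF X u] by metis
  have "u \<otimes> s = v \<otimes> (rep X u \<otimes> s)" using v s by (metis m_assoc)
  then show ?thesis using rep_mult_left[OF X v(1), of "rep X u \<otimes> s"] v(3) s by simp
qed

text \<open>Deodhar's lemma. If \<open>w s\<close> is shorter than \<open>w\<close>, it is minimal because multiplication by \<open>s\<close>
  changes lengths by one. If it is longer and not minimal, some \<open>t \<in> X\<close> shortens it, and by
  exchange the letter lost is \<open>s\<close>, so \<open>t w s = w\<close>.\<close>
lemma minimal_mult_gen:
  assumes X: "X \<subseteq> S" and w: "minimal X w" and s: "s \<in> S"
  shows "minimal X (w \<otimes> s) \<or> conjugate G w s \<in> X"
proof (cases "len (w \<otimes> s) < len w")
  case True
  have wcl: "w \<in> carrier G" using w by (simp add: minimal_iff)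
  have "len (w \<otimes> s) \<le> len (v \<otimes> (w \<otimes> s))" if v: "v \<in> generate G X" for v
  proof -
    have "len w \<le> len (v \<otimes> w)" using w v by (simp add: minimal_iff)
    moreover have "v \<otimes> (w \<otimes> s) = v \<otimes> w \<otimes> s"
      using parabolic_closed[OF X v] wcl s by (simp add: m_assoc)
    ultimately show ?thesis
      using len_mult_gen[of "v \<otimes> w" s] len_mult_gen[of w s] True s wcl parabolic_closed[OF X v]
      by fastforce
  qed
  then show ?thesis using wcl s by (simp add: minimal_iff)
next
  case False
  have wcl: "w \<in> carrier G" using w by (simp add: minimal_iff)
  have up: "len (w \<otimes> s) = Suc (len w)" using False len_mult_gen[OF wcl s] by simp
  show ?thesis
  proof (rule disjCI)
    assume nmin: "conjugate G w s \<notin> X"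
    obtain v where v: "minimal X (rep X (w \<otimes> s))" "v \<in> generate G X"
        "w \<otimes> s = v \<otimes> rep X (w \<otimes> s)" "rep X (w \<otimes> s) \<in> carrier G" "v \<in> carrier G"
      using repE[OF X, of "w \<otimes> s"] wcl s by auto
    obtain vs where vs: "set vs \<subseteq> X" "word_prod G vs = v" "length vs = len v"
      using reduced_word_parabolicE[OF X v(2)] by blast
    show "minimal X (w \<otimes> s)"
    proof (cases vs)
      case Nil
      then have "w \<otimes> s = rep X (w \<otimes> s)" using v(3,4) vs(2) by (metis l_one word_prod_simps(1))
      then show ?thesis using v(1) by simp
    next
      case (Cons t vs')
      \<comment> \<open>The first letter of \<open>v\<close> is a left descent of \<open>w s\<close>; the exchange condition turns
          it into the letter \<open>s\<close>, because it is not a left descent of \<open>w\<close>.\<close>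
      have t: "t \<in> X" "t \<in> S" "t \<in> carrier G" using Cons vs X by auto
      have vs': "set vs' \<subseteq> S" "word_prod G vs' \<in> generate G X"
        using Cons vs X word_prod_in_generate[of vs' X] by auto
      have "v = t \<otimes> word_prod G vs'" using Cons vs by simp
      then have "t \<otimes> (w \<otimes> s) = word_prod G vs' \<otimes> rep X (w \<otimes> s)"
        using t vs' v(3,4) gens_square[OF t(2)]
        by (metis l_one m_assoc m_closed wp_closed)
      then have "len (t \<otimes> (w \<otimes> s)) < len (w \<otimes> s)"
        using minimal_len_add[OF X v(1) vs'(2)] minimal_len_add[OF X v(1,2)] v(3)
          len_le[OF vs'(1)] vs(3) Cons by simp
      then have tlen: "len (t \<otimes> (w \<otimes> s)) < Suc (len w)" using up by simp
      have twlen: "len (t \<otimes> w) = Suc (len w)"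
        using minimal_len_add[OF X w, of t] t len_gen generate.incl[of t X G] by simp
      obtain ws where ws: "set ws \<subseteq> S" "word_prod G ws = w" "length ws = len w"
        using reduced_wordE[OF wcl] by blast
      have tws: "word_prod G (t # ws @ [s]) = t \<otimes> (w \<otimes> s)"
        using ws t s by (simp add: wp_append)
      obtain a p b q c where del: "t # ws @ [s] = a @ p # b @ q # c"
          "word_prod G (t # ws @ [s]) = word_prod G (a @ b @ c)"
        using deletion[of "t # ws @ [s]"] tws tlen ws t s by fastforce
      have False
      proof (cases a)
        case (Cons t' a')
        then have "ws @ [s] = a' @ p # b @ q # c" using del(1) by simp
        then have "set (ws @ [s]) = set (a' @ p # b @ q # c)"
          "length (ws @ [s]) = length (a' @ p # b @ q # c)" by metis+
        then have sub: "set (a' @ b @ c) \<subseteq> S" "length (a' @ b @ c) < len w"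
          using ws s by auto
        have "t \<otimes> (w \<otimes> s) = t \<otimes> word_prod G (a' @ b @ c)"
          using del Cons tws by simp
        then have "w \<otimes> s = word_prod G (a' @ b @ c)"
          using t wcl s sub(1) by simp
        then show False using len_le[OF sub(1)] sub(2) up by simp
      next
        case Nil
        then have bqc: "ws @ [s] = b @ q # c" using del(1) by simp
        show False
        proof (cases c rule: rev_cases)
          case Nil
          then have "b = ws" using bqc by simp
          then have "t \<otimes> (w \<otimes> s) = w" using del \<open>a = []\<close> Nil tws ws by simp
          then have "t \<otimes> (t \<otimes> (w \<otimes> s)) = t \<otimes> w" by simp
          then have "t \<otimes> w = w \<otimes> s"
            using t wcl s gens_square[OF t(2)] by (simp flip: m_assoc)
          then have "conjugate G w s = t" using wcl s t by (simp add: conjugate_eqI)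
          then show False using nmin t by simp
        next
          case (snoc c' s')
          then have wbc: "ws = b @ q # c'" "s' = s" using bqc by auto
          have sub: "set (b @ c') \<subseteq> S" using ws wbc by auto
          have "t \<otimes> w \<otimes> s = word_prod G (b @ c') \<otimes> s"
            using del \<open>a = []\<close> snoc wbc tws sub s t wcl by (simp add: wp_append m_assoc)
          then have "t \<otimes> w = word_prod G (b @ c')"
            using t wcl s sub by simp
          then show False using len_le[OF sub] twlen ws(3) wbc by simp
        qed
      qed
      then show ?thesis ..
    qed
  qed
qed

lemma rep_mult_gen:
  assumes X: "X \<subseteq> S" and u: "u \<in> carrier G" and s: "s \<in> S"
  shows "rep X (u \<otimes> s) =
     (if conjugate G (rep X u) s \<in> X then rep X u else rep X u \<otimes> s)"
proof -
  let ?w = "rep X u"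
  have w: "minimal X ?w" "?w \<in> carrier G" using repE[OF X u] by auto
  have eq: "rep X (u \<otimes> s) = rep X (?w \<otimes> s)" using rep_rep[OF X u] s by simp
  show ?thesis
  proof (cases "conjugate G ?w s \<in> X")
    case True
    have "?w \<otimes> s = conjugate G ?w s \<otimes> ?w" using w s by (simp add: conjugate_mult_right)
    from rep_eqI[OF X w(1) generate.incl[OF True] this] show ?thesis using True eq by metis
  next
    case False
    then have "minimal X (?w \<otimes> s)" using minimal_mult_gen[OF X w(1) s] by simp
    from rep_eqI[OF X this generate.one, of "?w \<otimes> s"] have "rep X (?w \<otimes> s) = ?w \<otimes> s"
      using w s by simp
    then show ?thesis using False eq by metis
  qed
qed

lemma decomposition_step:
  assumes X: "X \<subseteq> S" and u: "u \<in> carrier G" and s: "s \<in> S"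
    and v: "u = v \<otimes> rep X u" "v \<in> carrier G"
  shows "u \<otimes> s =
    (if conjugate G (rep X u) s \<in> X then v \<otimes> conjugate G (rep X u) s else v) \<otimes> rep X (u \<otimes> s)"
proof -
  have w: "rep X u \<in> carrier G" using X u by simp
  have "u \<otimes> s = v \<otimes> (rep X u \<otimes> s)" using w s v by (metis gen_closed m_assoc)
  moreover have "rep X u \<otimes> s = conjugate G (rep X u) s \<otimes> rep X u"
    using w s by (simp add: conjugate_mult_right)
  ultimately show ?thesis
    using rep_mult_gen[OF X u s] w s v(2) by (simp add: m_assoc)
qed

text \<open>For this reason the letters \<open>\<sigma>\<^sub>z\<close> and \<open>\<sigma>\<^sub>z\<^sup>-\<^sup>1\<close> are treated alike, although the generator to be
  printed is defined from the state before the letter for one and after the letter for the other.\<close>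
lemma conjugate_rep_mult_gen:
  assumes X: "X \<subseteq> S" and u: "u \<in> carrier G" and s: "s \<in> S"
  shows "conjugate G (rep X (u \<otimes> s)) s = conjugate G (rep X u) s"
proof -
  have "conjugate G (rep X u \<otimes> s) s = conjugate G (rep X u) (conjugate G s s)"
    using X u s by (simp add: conjugate_comp del: conjugate_self)
  also have "conjugate G s s = s" using s by simp
  finally show ?thesis using rep_mult_gen[OF X u s] by simp
qed

section \<open>Reading a word through the cosets\<close>

text \<open>Here \<open>w0\<close> is the shortest element of the double coset of \<open>u\<close>. It is minimal on both sides, and
  induction along a word over \<open>Y\<close> shows that every representative met in the double coset is \<open>w0 e\<close>
  with \<open>e\<close> in the subgroup of \<open>Y\<close>. If \<open>t \<in> X\<close> is the conjugate of \<open>s \<in> Y\<close> by \<open>w0 e\<close>, then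
  \<open>t w0 = w0 r\<close> with \<open>r = e s e\<^sup>-\<^sup>1\<close>, and additivity of the lengths of both sides leaves no choice but
  \<open>r \<in> Y\<close>.\<close>
lemma parabolic_loops:
  assumes X: "X \<subseteq> S" and Y: "Y \<subseteq> S" and u: "u \<in> carrier G"
  shows "\<exists>w0\<in>carrier G. (\<exists>d0\<in>generate G Y. rep X (u \<otimes> d0) = w0) \<and>
    (\<forall>d\<in>generate G Y. \<forall>s\<in>Y. conjugate G (rep X (u \<otimes> d)) s \<in> X \<longrightarrow>
       conjugate G (rep X (u \<otimes> d)) s \<in> conjugate G w0 ` Y)"
proof -
  let ?D = "{v \<otimes> (u \<otimes> d) | v d. v \<in> generate G X \<and> d \<in> generate G Y}"
  note sgX = subgroup_parabolic[OF X] and sgY = subgroup_parabolic[OF Y]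
  note clX = parabolic_closed[OF X] and clY = parabolic_closed[OF Y]
  have "\<one> \<otimes> (u \<otimes> \<one>) \<in> ?D" using generate.one by blast
  then obtain w0 where "w0 \<in> ?D" and least: "\<And>w. w \<in> ?D \<Longrightarrow> len w0 \<le> len w"
    using ex_has_least_nat[of "\<lambda>w. w \<in> ?D" _ len] by blast
  then obtain v0 d0 where v0: "v0 \<in> generate G X" and d0: "d0 \<in> generate G Y"
    and w0: "w0 = v0 \<otimes> (u \<otimes> d0)" by blast
  have w0cl: "w0 \<in> carrier G" using w0 v0 d0 u clX clY by simp
  have minX: "minimal X w0"
  proof -
    have "v \<otimes> w0 \<in> ?D" if "v \<in> generate G X" for v
    proof -
      have "v \<otimes> w0 = (v \<otimes> v0) \<otimes> (u \<otimes> d0)"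
        using that w0 v0 d0 u clX clY by (simp add: m_assoc)
      then show ?thesis using subgroup.m_closed[OF sgX that v0] d0 by blast
    qed
    then show ?thesis using least w0cl by (simp add: minimal_iff)
  qed
  have minY: "minimal Y (inv w0)"
  proof -
    have "len (inv w0) \<le> len (d \<otimes> inv w0)" if d: "d \<in> generate G Y" for d
    proof -
      have "w0 \<otimes> inv d = v0 \<otimes> (u \<otimes> (d0 \<otimes> inv d))"
        using d w0 v0 d0 u clX clY by (simp add: m_assoc)
      then have "w0 \<otimes> inv d \<in> ?D"
        using subgroup.m_closed[OF sgY d0 subgroup.m_inv_closed[OF sgY d]] v0 by blast
      then have "len w0 \<le> len (w0 \<otimes> inv d)" by (rule least)
      also have "\<dots> = len (d \<otimes> inv w0)"
        using len_inv[of "w0 \<otimes> inv d"] d clY w0cl by (simp add: inv_mult_group)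
      finally show ?thesis using len_inv[OF w0cl] by simp
    qed
    then show ?thesis using w0cl by (simp add: minimal_iff)
  qed
  have rep_w0: "rep X (w0 \<otimes> e) = rep X (u \<otimes> (d0 \<otimes> e))" if "e \<in> generate G Y" for e
    using rep_mult_left[OF X v0, of "u \<otimes> (d0 \<otimes> e)"] w0 v0 d0 u clX clY that
    by (simp add: m_assoc)
  have orbit: "\<exists>e\<in>generate G Y. rep X (w0 \<otimes> word_prod G ys) = w0 \<otimes> e"
    if "set ys \<subseteq> Y" for ys
    using that
  proof (induction ys rule: rev_induct)
    case Nil
    then show ?case using rep_eqI[OF X minX generate.one] w0cl generate.one by force
  next
    case (snoc s ys)
    then obtain e where e: "e \<in> generate G Y" "rep X (w0 \<otimes> word_prod G ys) = w0 \<otimes> e" by auto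
    have s: "s \<in> Y" "s \<in> S" "set ys \<subseteq> S" using snoc Y by auto
    have "w0 \<otimes> word_prod G (ys @ [s]) = w0 \<otimes> word_prod G ys \<otimes> s"
      using s w0cl by (simp add: wp_append m_assoc)
    then have "rep X (w0 \<otimes> word_prod G (ys @ [s])) \<in> {w0 \<otimes> e, w0 \<otimes> e \<otimes> s}"
      using rep_mult_gen[OF X, of "w0 \<otimes> word_prod G ys" s] s w0cl e(2) by simp
    moreover have "w0 \<otimes> e \<otimes> s = w0 \<otimes> (e \<otimes> s)" using w0cl e s clY by (simp add: m_assoc)
    moreover have "e \<otimes> s \<in> generate G Y" using e s by (blast intro: generate.intros)
    ultimately show ?case using e(1) by auto
  qed
  have "conjugate G (rep X (u \<otimes> d)) s \<in> conjugate G w0 ` Y"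
    if d: "d \<in> generate G Y" and s: "s \<in> Y" and tX: "conjugate G (rep X (u \<otimes> d)) s \<in> X" for d s
  proof -
    have d0d: "inv d0 \<otimes> d \<in> generate G Y"
      using subgroup.m_closed[OF sgY subgroup.m_inv_closed[OF sgY d0] d] .
    obtain ys where ys: "set ys \<subseteq> Y" "word_prod G ys = inv d0 \<otimes> d"
      using generate_wordE[OF Y d0d] by blast
    have "rep X (u \<otimes> d) = rep X (w0 \<otimes> word_prod G ys)"
      using rep_w0[OF d0d] ys d d0 clY by simp
    then obtain e where e: "e \<in> generate G Y" "rep X (u \<otimes> d) = w0 \<otimes> e"
      using orbit[OF ys(1)] by auto
    define t where "t = conjugate G (rep X (u \<otimes> d)) s"
    define r where "r = conjugate G e s"
    have ecl: "e \<in> carrier G" using e clY by simp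
    have scl: "s \<in> carrier G" using s Y by auto
    have rY: "r \<in> generate G Y"
      unfolding r_def conjugate_def using e s
      by (meson generate.incl sgY subgroup.m_closed subgroup.m_inv_closed)
    have rcl: "r \<in> carrier G" using rY clY by simp
    have t: "t = conjugate G w0 r"
      using e w0cl scl ecl by (simp add: t_def r_def conjugate_comp)
    have tS: "t \<in> X" "t \<in> S" using tX X by (auto simp: t_def)
    \<comment> \<open>Both sides of \<open>t w\<^sub>0 = w\<^sub>0 r\<close> have additive length, so \<open>r\<close> is a single letter.\<close>
    have "len (t \<otimes> w0) = Suc (len w0)"
      using minimal_len_add[OF X minX generate.incl[OF tS(1)]] len_gen[OF tS(2)] by simp
    moreover have "len (t \<otimes> w0) = len (inv r) + len w0"
    proof -
      have "t \<otimes> w0 = w0 \<otimes> r" using t w0cl rcl by (simp add: conjugate_mult_right)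
      moreover have "len (w0 \<otimes> r) = len (inv r \<otimes> inv w0)"
        using len_inv[of "w0 \<otimes> r"] w0cl rcl by (simp add: inv_mult_group)
      ultimately show ?thesis
        using minimal_len_add[OF Y minY subgroup.m_inv_closed[OF sgY rY]] len_inv[OF w0cl] by simp
    qed
    ultimately have "len r = 1" using len_inv[OF rcl] by simp
    then obtain rs where "set rs \<subseteq> Y" "word_prod G rs = r" "length rs = 1"
      using reduced_word_parabolicE[OF Y rY] by metis
    then have "r \<in> Y" using Y by (cases rs) auto
    then show ?thesis using t by (simp add: t_def)
  qed
  moreover have "rep X (u \<otimes> d0) = w0"
    using rep_w0[OF generate.one] rep_eqI[OF X minX generate.one] w0cl d0 clY by simp
  ultimately show ?thesis using w0cl d0 by blast
qed

text \<open>The generators printed while the word is read from the coset of \<open>u\<close>.\<close>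
primrec trace :: "'a set \<Rightarrow> 'a \<Rightarrow> 'a list \<Rightarrow> 'a list" where
  "trace X u [] = []"
| "trace X u (s # ws) =
     (let t = conjugate G (rep X u) s in if t \<in> X then [t] else []) @ trace X (u \<otimes> s) ws"

lemma set_trace: "set (trace X u ws) \<subseteq> X"
  by (induction ws arbitrary: u) (auto simp: Let_def)

text \<open>The printed word records how the component in the parabolic subgroup changes.\<close>
lemma trace_word_prod:
  assumes X: "X \<subseteq> S" and "set ws \<subseteq> S" "u = v \<otimes> rep X u" "v \<in> carrier G" "u \<in> carrier G"
  shows "u \<otimes> word_prod G ws
    = v \<otimes> word_prod G (trace X u ws) \<otimes> rep X (u \<otimes> word_prod G ws)"
  using assms(2-)
proof (induction ws arbitrary: u v)
  case Nil
  then show ?case by simp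
next
  case (Cons s ws)
  define w where "w = rep X u"
  have s: "s \<in> S" "s \<in> carrier G" "set ws \<subseteq> S" "set ws \<subseteq> carrier G"
    using Cons.prems gens_closed by auto
  have w: "w \<in> carrier G" using X Cons.prems by (simp add: w_def)
  have tr: "set (trace X (u \<otimes> s) ws) \<subseteq> carrier G"
    using set_trace[of X "u \<otimes> s" ws] X gens_closed by blast
  have us: "u \<otimes> word_prod G (s # ws) = (u \<otimes> s) \<otimes> word_prod G ws"
    using Cons.prems s by (simp add: m_assoc)
  have uw: "u = v \<otimes> w" using Cons.prems by (simp add: w_def)
  show ?case
  proof (cases "conjugate G w s \<in> X")
    case True
    define t where "t = conjugate G w s"
    have t: "t \<in> carrier G" using w s by (simp add: t_def)
    have "u \<otimes> s = v \<otimes> t \<otimes> rep X (u \<otimes> s)"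
      using decomposition_step[OF X Cons.prems(4) s(1) Cons.prems(2,3)] True
      by (simp add: w_def t_def)
    from Cons.IH[OF s(3) this] show ?thesis
      using us True t tr Cons.prems s by (simp add: t_def w_def Let_def m_assoc)
  next
    case False
    have "u \<otimes> s = v \<otimes> rep X (u \<otimes> s)"
      using decomposition_step[OF X Cons.prems(4) s(1) Cons.prems(2,3)] False
      by (simp add: w_def)
    from Cons.IH[OF s(3) this] show ?thesis
      using us False Cons.prems s by (simp add: w_def Let_def m_assoc)
  qed
qed

text \<open>If the letter \<open>s\<close> read at \<open>u = v w\<close> prints \<open>t = w s w\<^sup>-\<^sup>1\<close>, then \<open>u s u\<^sup>-\<^sup>1 = v t v\<^sup>-\<^sup>1\<close>, so the inversions
  of the printed word are the inversions of the given word at the printed positions.\<close>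
lemma trace_inversions_subseq:
  assumes X: "X \<subseteq> S" and "set ws \<subseteq> S" "u = v \<otimes> rep X u" "v \<in> carrier G" "u \<in> carrier G"
  shows "subseq (map (conjugate G v) (inversions G (trace X u ws)))
     (map (conjugate G u) (inversions G ws))"
  using assms(2-)
proof (induction ws arbitrary: u v)
  case Nil
  then show ?case by simp
next
  case (Cons s ws)
  define w where "w = rep X u"
  have s: "s \<in> S" "s \<in> carrier G" "set ws \<subseteq> S" "set ws \<subseteq> carrier G"
    using Cons.prems gens_closed by auto
  have w: "w \<in> carrier G" using X Cons.prems by (simp add: w_def)
  have tr: "set (inversions G (trace X (u \<otimes> s) ws)) \<subseteq> carrier G"
    using set_trace[of X "u \<otimes> s" ws] X gens_closed by (intro inversions_closed) blast
  have uw: "u = v \<otimes> w" using Cons.prems by (simp add: w_def)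
  have inv_s: "map (conjugate G u) (inversions G (s # ws))
      = conjugate G u s # map (conjugate G (u \<otimes> s)) (inversions G ws)"
    using map_conjugate_comp[OF Cons.prems(4) s(2) inversions_closed[OF s(4)]] by simp
  show ?case
  proof (cases "conjugate G w s \<in> X")
    case True
    define t where "t = conjugate G w s"
    have t: "t \<in> carrier G" using w s by (simp add: t_def)
    have "u \<otimes> s = v \<otimes> t \<otimes> rep X (u \<otimes> s)"
      using decomposition_step[OF X Cons.prems(4) s(1) Cons.prems(2,3)] True
      by (simp add: w_def t_def)
    from Cons.IH[OF s(3) this]
    have "subseq (map (conjugate G (v \<otimes> t)) (inversions G (trace X (u \<otimes> s) ws)))
       (map (conjugate G (u \<otimes> s)) (inversions G ws))"
      using Cons.prems s t by simp
    moreover have "conjugate G u s = conjugate G v t"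
      using uw t_def w s Cons.prems(3) by (simp add: conjugate_comp)
    moreover have "trace X u (s # ws) = t # trace X (u \<otimes> s) ws"
      using True by (simp add: t_def w_def Let_def)
    moreover have "map (conjugate G v) (map (conjugate G t) (inversions G (trace X (u \<otimes> s) ws)))
       = map (conjugate G (v \<otimes> t)) (inversions G (trace X (u \<otimes> s) ws))"
      by (rule map_conjugate_comp[OF Cons.prems(3) t tr])
    ultimately show ?thesis unfolding inv_s by (simp del: trace.simps map_map)
  next
    case False
    have "u \<otimes> s = v \<otimes> rep X (u \<otimes> s)"
      using decomposition_step[OF X Cons.prems(4) s(1) Cons.prems(2,3)] False
      by (simp add: w_def)
    from Cons.IH[OF s(3) this]
    have "subseq (map (conjugate G v) (inversions G (trace X (u \<otimes> s) ws)))
       (map (conjugate G (u \<otimes> s)) (inversions G ws))"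
      using Cons.prems s by simp
    moreover have "trace X u (s # ws) = trace X (u \<otimes> s) ws"
      using False by (simp add: w_def Let_def)
    ultimately show ?thesis unfolding inv_s by (simp only: list_emb_Cons)
  qed
qed

lemma distinct_trace_inversions:
  assumes X: "X \<subseteq> S" and ws: "set ws \<subseteq> S" "distinct (inversions G ws)" and u: "u \<in> carrier G"
  shows "distinct (inversions G (trace X u ws))"
proof -
  obtain v where v: "u = v \<otimes> rep X u" "v \<in> carrier G"
    using repE[OF X u] by metis
  have "set (inversions G ws) \<subseteq> carrier G"
    using inversions_closed ws(1) gens_closed by blast
  then have "inj_on (conjugate G u) (set (inversions G ws))"
    using u by (auto intro!: inj_onI simp: subset_iff)
  then have "distinct (map (conjugate G u) (inversions G ws))"
    using ws(2) by (simp add: distinct_map)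
  then show ?thesis
    using trace_inversions_subseq[OF X ws(1) v u] by (metis subseq_conv_nths distinct_nthsI distinct_map)
qed

lemma trace_const:
  assumes "set ws \<subseteq> Y" "Y \<subseteq> S" "X \<subseteq> S" "u \<in> carrier G" "conjugate G w0 ` Y \<subseteq> X"
    and "\<And>d. d \<in> generate G Y \<Longrightarrow> rep X (u \<otimes> d) = w0"
  shows "trace X u ws = map (conjugate G w0) ws"
  using assms
proof (induction ws arbitrary: u)
  case Nil
  then show ?case by simp
next
  case (Cons s ws)
  have s: "s \<in> Y" "s \<in> S" using Cons.prems by auto
  have "rep X u = w0" using Cons.prems(4) Cons.prems(6)[OF generate.one] by simp
  moreover have "rep X (u \<otimes> s \<otimes> d) = w0" if "d \<in> generate G Y" for d
  proof -
    have "u \<otimes> s \<otimes> d = u \<otimes> (s \<otimes> d)"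
      using Cons.prems s parabolic_closed[OF Cons.prems(2) that] by (simp add: m_assoc)
    then show ?thesis using Cons.prems(6)[of "s \<otimes> d"] s that by (auto intro: generate.intros)
  qed
  ultimately show ?case using Cons s by (auto simp: Let_def)
qed

lemma trace_letters:
  assumes "set ws \<subseteq> Y" "Y \<subseteq> S" "u \<in> carrier G"
    and "\<And>d s. d \<in> generate G Y \<Longrightarrow> s \<in> Y \<Longrightarrow> conjugate G (rep X (u \<otimes> d)) s \<in> X \<Longrightarrow>
        conjugate G (rep X (u \<otimes> d)) s \<in> T"
  shows "set (trace X u ws) \<subseteq> T"
  using assms
proof (induction ws arbitrary: u)
  case Nil
  then show ?case by simp
next
  case (Cons s ws)
  have s: "s \<in> Y" "s \<in> S" using Cons.prems by auto
  have "set (trace X (u \<otimes> s) ws) \<subseteq> T"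
  proof (rule Cons.IH)
    fix d s' assume d: "d \<in> generate G Y" "s' \<in> Y" "conjugate G (rep X (u \<otimes> s \<otimes> d)) s' \<in> X"
    have "u \<otimes> s \<otimes> d = u \<otimes> (s \<otimes> d)"
      using Cons.prems s parabolic_closed[OF Cons.prems(2) d(1)] by (simp add: m_assoc)
    then show "conjugate G (rep X (u \<otimes> s \<otimes> d)) s' \<in> T"
      using Cons.prems(4)[of "s \<otimes> d" s'] s d by (auto intro: generate.intros)
  qed (use Cons.prems s in auto)
  moreover have "conjugate G (rep X u) s \<in> T" if "conjugate G (rep X u) s \<in> X"
    using Cons.prems(4)[OF generate.one s(1)] that Cons.prems(3) by simp
  ultimately show ?case by (auto simp: Let_def)
qed

lemma distinct_inversions_replicate:
  assumes "set ws \<subseteq> {t}" "t \<in> S" "distinct (inversions G ws)"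
  shows "ws = [] \<or> ws = [t]"
proof (cases ws)
  case (Cons a vs)
  show ?thesis
  proof (cases vs)
    case (Cons b vs')
    then have "inversions G ws = t # conjugate G t t # map (conjugate G t) (map (conjugate G t) (inversions G vs'))"
      using assms(1) \<open>ws = a # vs\<close> by auto
    then show ?thesis using assms by (simp add: conjugate_def m_assoc)
  qed (use Cons assms in auto)
qed simp

text \<open>To be applied to the two sides of a braid relation. If both conjugates by \<open>w0\<close> lie in \<open>X\<close>,
  all representatives met are equal to \<open>w0\<close>. Otherwise at most one generator \<open>t\<close> can be printed, at
  most once because the inversions are distinct, and the values of the outputs agree.\<close>
lemma trace_dihedral:
  assumes X: "X \<subseteq> S" and ab: "a \<in> S" "b \<in> S" and u: "u \<in> carrier G"
    and us: "set us \<subseteq> {a, b}" "distinct (inversions G us)"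
    and ws: "set ws \<subseteq> {a, b}" "distinct (inversions G ws)"
    and eq: "word_prod G us = word_prod G ws"
  shows "trace X u us = trace X u ws \<or>
    (\<exists>w0\<in>carrier G. conjugate G w0 a \<in> X \<and> conjugate G w0 b \<in> X \<and>
       trace X u us = map (conjugate G w0) us \<and> trace X u ws = map (conjugate G w0) ws)"
proof -
  let ?Y = "{a, b}"
  have Y: "?Y \<subseteq> S" using ab by simp
  note sgY = subgroup_parabolic[OF Y]
  obtain w0 d0 where w0: "w0 \<in> carrier G" "d0 \<in> generate G ?Y" "rep X (u \<otimes> d0) = w0"
    and loops: "\<And>d s. d \<in> generate G ?Y \<Longrightarrow> s \<in> ?Y \<Longrightarrow> conjugate G (rep X (u \<otimes> d)) s \<in> X \<Longrightarrow>
       conjugate G (rep X (u \<otimes> d)) s \<in> conjugate G w0 ` ?Y"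
    using parabolic_loops[OF X Y u] by metis
  show ?thesis
  proof (cases "conjugate G w0 ` ?Y \<subseteq> X")
    case True
    have conj: "conjugate G w0 d \<in> generate G X" if d: "d \<in> generate G ?Y" for d
    proof -
      obtain ds where ds: "set ds \<subseteq> ?Y" "word_prod G ds = d"
        using generate_wordE[OF Y d] by blast
      have "conjugate G w0 d = word_prod G (map (conjugate G w0) ds)"
        using conjugate_word_prod[OF w0(1), of ds] ds Y gens_closed by auto
      moreover have "set (map (conjugate G w0) ds) \<subseteq> X" using ds True by auto
      ultimately show ?thesis using word_prod_in_generate by metis
    qed
    have const: "rep X (u \<otimes> d) = w0" if d: "d \<in> generate G ?Y" for d
    proof -
      have e: "inv d0 \<otimes> d \<in> generate G ?Y"
        using subgroup.m_closed[OF sgY subgroup.m_inv_closed[OF sgY w0(2)] d] .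
      have cl: "d \<in> carrier G" "d0 \<in> carrier G" "inv d0 \<otimes> d \<in> carrier G"
        using parabolic_closed[OF Y] d w0(2) e by auto
      have "rep X (u \<otimes> d) = rep X ((u \<otimes> d0) \<otimes> (inv d0 \<otimes> d))"
        using cl u by (simp add: m_assoc)
      also have "\<dots> = rep X (w0 \<otimes> (inv d0 \<otimes> d))"
        using rep_rep[OF X, of "u \<otimes> d0" "inv d0 \<otimes> d"] cl u w0(3) by simp
      also have "\<dots> = rep X (conjugate G w0 (inv d0 \<otimes> d) \<otimes> w0)"
        using conjugate_mult_right w0(1) cl by simp
      also have "\<dots> = rep X w0" using rep_mult_left[OF X conj[OF e] w0(1)] .
      also have "\<dots> = rep X (rep X (u \<otimes> d0) \<otimes> \<one>)" using w0 by simp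
      also have "\<dots> = w0" using rep_rep[OF X, of "u \<otimes> d0" \<one>] cl u w0 by simp
      finally show ?thesis .
    qed
    show ?thesis
      using trace_const[OF us(1) Y X u True const] trace_const[OF ws(1) Y X u True const]
        True w0(1) by auto
  next
    case False
    then obtain t where t: "t \<in> S" "conjugate G w0 ` ?Y \<inter> X \<subseteq> {t}"
    proof -
      from False consider "conjugate G w0 a \<notin> X" | "conjugate G w0 b \<notin> X" by auto
      then show ?thesis
      proof cases
        case 1
        show ?thesis
          by (cases "conjugate G w0 b \<in> X") (rule that[of "conjugate G w0 b"] that[of a]; use 1 X ab in auto)+
      next
        case 2
        show ?thesis
          by (cases "conjugate G w0 a \<in> X") (rule that[of "conjugate G w0 a"] that[of a]; use 2 X ab in auto)+
      qed
    qed
    have short: "trace X u vs = [] \<or> trace X u vs = [t]"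
      if "set vs \<subseteq> ?Y" "distinct (inversions G vs)" for vs
    proof (rule distinct_inversions_replicate[OF _ t(1)])
      show "set (trace X u vs) \<subseteq> {t}"
        by (rule trace_letters[OF that(1) Y u]) (use loops t(2) in blast)
      show "distinct (inversions G (trace X u vs))"
        using distinct_trace_inversions[OF X _ that(2) u] that(1) Y by blast
    qed
    obtain v where v: "u = v \<otimes> rep X u" "v \<in> carrier G"
      using repE[OF X u] by metis
    have S: "set us \<subseteq> S" "set ws \<subseteq> S" using us ws Y by auto
    have trS: "set (trace X u us) \<subseteq> S" "set (trace X u ws) \<subseteq> S"
      using set_trace X by fast+
    have "v \<otimes> word_prod G (trace X u us) \<otimes> rep X (u \<otimes> word_prod G us)
        = v \<otimes> word_prod G (trace X u ws) \<otimes> rep X (u \<otimes> word_prod G us)"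
      using trace_word_prod[OF X S(1) v u] trace_word_prod[OF X S(2) v u] eq by simp
    then have "word_prod G (trace X u us) = word_prod G (trace X u ws)"
      using v(2) u X S trS by simp
    moreover have "t \<noteq> \<one>" using len_gen[OF t(1)] len_one by auto
    ultimately show ?thesis
      using short[OF us] short[OF ws] t(1) by auto
  qed
qed

end

section \<open>Alternating words\<close>

lemma alternating_conv_map:
  "alternating a b n = map (\<lambda>i. if even i then a else b) [0..<n]"
  by (induction n arbitrary: a b) (auto simp: upt_conv_Cons map_Suc_upt[symmetric] simp del: upt_Suc)

lemma length_alternating [simp]: "length (alternating a b n) = n"
  by (simp add: alternating_conv_map)

lemma map_alternating: "map f (alternating a b n) = alternating (f a) (f b) n"
  by (simp add: alternating_conv_map)

text \<open>Since generators are involutions, this identity translates between the braid relation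
  \<open>aba\<dots> = bab\<dots>\<close> of length \<open>n\<close> and the relation \<open>(ab)\<^sup>n = 1\<close>.\<close>
lemma alternating_double: "alternating a b (2 * n) = alternating a b n @ rev (alternating b a n)"
proof (rule nth_equalityI)
  fix i assume "i < length (alternating a b (2 * n))"
  then have i: "i < 2 * n" by simp
  show "alternating a b (2 * n) ! i = (alternating a b n @ rev (alternating b a n)) ! i"
  proof (cases "i < n")
    case False
    then have "n - Suc (i - n) = 2 * n - Suc i" using i by simp
    then show ?thesis
      using i False by (simp add: alternating_conv_map nth_append rev_nth)
  qed (use i in \<open>simp add: alternating_conv_map nth_append\<close>)
qed simp

context group
begin

lemma word_prod_alternating_double:
  "a \<in> carrier G \<Longrightarrow> b \<in> carrier G \<Longrightarrow> word_prod G (alternating a b (2 * n)) = (a \<otimes> b) [^] n"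
proof (induction n)
  case (Suc n)
  have "word_prod G (alternating a b (2 * Suc n)) = (a \<otimes> b) \<otimes> (a \<otimes> b) [^] n"
    using Suc by (simp add: m_assoc)
  then show ?case using Suc.prems nat_pow_Suc2[of "a \<otimes> b" n] by simp
qed simp

lemma inversions_alternating:
  assumes "a \<in> carrier G" "b \<in> carrier G" "a \<otimes> a = \<one>" "b \<otimes> b = \<one>"
  shows "inversions G (alternating a b n) = map (\<lambda>i. (a \<otimes> b) [^] i \<otimes> a) [0..<n]"
  using assms
proof (induction n arbitrary: a b)
  case (Suc n)
  have inv_a: "inv a = a" using Suc.prems by (simp add: inv_equality)
  have shift: "a \<otimes> (b \<otimes> a) [^] i = (a \<otimes> b) [^] i \<otimes> a" for i :: nat
    using Suc.prems
  proof (induction i)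
    case (Suc i)
    have "a \<otimes> (b \<otimes> a) [^] Suc i = (a \<otimes> (b \<otimes> a) [^] i) \<otimes> (b \<otimes> a)"
      using Suc.prems by (simp add: m_assoc)
    also have "\<dots> = (a \<otimes> b) [^] Suc i \<otimes> a"
      using Suc by (simp add: m_assoc)
    finally show ?case .
  qed simp
  have "conjugate G a ((b \<otimes> a) [^] i \<otimes> b) = (a \<otimes> b) [^] Suc i \<otimes> a" for i :: nat
  proof -
    have "conjugate G a ((b \<otimes> a) [^] i \<otimes> b) = (a \<otimes> (b \<otimes> a) [^] i) \<otimes> b \<otimes> a"
      using Suc.prems by (simp add: conjugate_def inv_a m_assoc)
    then show ?thesis using shift Suc.prems by (simp add: m_assoc)
  qed
  then have "inversions G (alternating a b (Suc n))
    = a # map (\<lambda>i. (a \<otimes> b) [^] Suc i \<otimes> a) [0..<n]"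
    using Suc by simp
  then show ?case
    using Suc.prems by (simp add: upt_conv_Cons map_Suc_upt[symmetric] del: upt_Suc nat_pow_Suc)
qed simp

text \<open>With \<open>k = n - i - 1\<close>, the relation \<open>(ab)\<^sup>n = 1\<close> gives \<open>(ab)\<^sup>k a = (ba)\<^sup>i b\<close>. Hence both sides of
  a braid relation have the same inversions with the same multiplicities.\<close>
lemma inversions_alternating_rev:
  assumes ab: "a \<in> carrier G" "b \<in> carrier G" "a \<otimes> a = \<one>" "b \<otimes> b = \<one>"
    and one: "(a \<otimes> b) [^] n = \<one>"
  shows "inversions G (alternating b a n) = rev (inversions G (alternating a b n))"
proof (rule nth_equalityI)
  fix i assume "i < length (inversions G (alternating b a n))"
  then have i: "i < n" by simp
  define k where "k = n - Suc i"
  have n: "n = i + Suc k" using i by (simp add: k_def)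
  have inv_ab: "inv (a \<otimes> b) = b \<otimes> a"
    using ab by (simp add: inv_mult_group inv_equality)
  have "(a \<otimes> b) [^] i \<otimes> ((a \<otimes> b) [^] k \<otimes> a \<otimes> b) = \<one>"
    using one ab unfolding n by (simp add: m_assoc flip: nat_pow_mult)
  then have "(a \<otimes> b) [^] k \<otimes> a \<otimes> b = inv ((a \<otimes> b) [^] i)"
    using ab by (metis inv_equality inv_comm m_closed nat_pow_closed)
  also have "\<dots> = (b \<otimes> a) [^] i"
    using ab by (simp add: nat_pow_inv[symmetric] inv_ab)
  finally have "(a \<otimes> b) [^] k \<otimes> a \<otimes> b \<otimes> b = (b \<otimes> a) [^] i \<otimes> b" by simp
  then have "(a \<otimes> b) [^] k \<otimes> a = (b \<otimes> a) [^] i \<otimes> b"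
    using ab by (simp add: m_assoc)
  then show "inversions G (alternating b a n) ! i = rev (inversions G (alternating a b n)) ! i"
    using i ab by (simp add: inversions_alternating rev_nth k_def)
qed simp

lemma distinct_inversions_alternating:
  assumes ab: "a \<in> carrier G" "b \<in> carrier G" "a \<otimes> a = \<one>" "b \<otimes> b = \<one>"
    and ord: "\<And>k. 0 < k \<Longrightarrow> k < n \<Longrightarrow> (a \<otimes> b) [^] k \<noteq> \<one>"
  shows "distinct (inversions G (alternating a b n))"
proof -
  have less: False if "i < j" "j < n" "(a \<otimes> b) [^] i \<otimes> a = (a \<otimes> b) [^] j \<otimes> a" for i j :: nat
  proof -
    have "(a \<otimes> b) [^] i = (a \<otimes> b) [^] j" using that ab by simp
    moreover have "(a \<otimes> b) [^] i \<otimes> (a \<otimes> b) [^] (j - i) = (a \<otimes> b) [^] j"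
      using that(1) ab by (simp add: nat_pow_mult)
    ultimately have "(a \<otimes> b) [^] i \<otimes> (a \<otimes> b) [^] (j - i) = (a \<otimes> b) [^] i \<otimes> \<one>"
      using ab by simp
    then have "(a \<otimes> b) [^] (j - i) = \<one>" using ab by (simp del: r_one)
    then show False using ord[of "j - i"] that by simp
  qed
  then show ?thesis
    unfolding inversions_alternating[OF ab] by (auto simp: distinct_map inj_on_def) (metis nat_neq_iff)
qed

end

section \<open>The geometric representation\<close>

text \<open>Twice the value of Tits's symmetric form on two basis vectors.\<close>
definition reflection_coeff :: "'v labelled_graph \<Rightarrow> 'v \<Rightarrow> 'v \<Rightarrow> real" where
  "reflection_coeff \<Gamma> x z =
     (if x = z then 2 else if {x, z} \<in> edges \<Gamma> then - 2 * cos (pi / label \<Gamma> {x, z}) else - 2)"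

text \<open>The dual of the geometric representation: \<open>f\<close> stands for a linear form, given by its values on the
  basis. On forms, the reflection in \<open>x\<close> changes each coordinate by a multiple of \<open>f x\<close>.\<close>
definition reflect :: "'v labelled_graph \<Rightarrow> 'v \<Rightarrow> ('v \<Rightarrow> real) \<Rightarrow> 'v \<Rightarrow> real" where
  "reflect \<Gamma> x f = (\<lambda>z. f z - reflection_coeff \<Gamma> x z * f x)"

primrec act :: "'v labelled_graph \<Rightarrow> 'v signed_word \<Rightarrow> ('v \<Rightarrow> real) \<Rightarrow> 'v \<Rightarrow> real" where
  "act \<Gamma> [] f = f"
| "act \<Gamma> (l # \<alpha>) f = reflect \<Gamma> (fst l) (act \<Gamma> \<alpha> f)"

lemma reflect_reflect [simp]: "reflect \<Gamma> x (reflect \<Gamma> x f) = f"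
  by (auto simp: reflect_def reflection_coeff_def algebra_simps)

lemma act_append: "act \<Gamma> (\<alpha> @ \<beta>) f = act \<Gamma> \<alpha> (act \<Gamma> \<beta> f)"
  by (induction \<alpha>) auto

lemma act_rev [simp]: "act \<Gamma> (rev \<alpha>) (act \<Gamma> \<alpha> f) = f"
  by (induction \<alpha> arbitrary: f) (auto simp: act_append)

text \<open>Trigonometric identities for the recursion in the next lemma: \<open>c\<close>, \<open>s\<close> are the cosine and sine
  of \<open>\<theta>\<close>, and \<open>C\<close>, \<open>S\<close> those of an angle \<open>\<phi>\<close>, so that \<open>C'\<close> and \<open>S'\<close> belong to \<open>\<phi> + 2\<theta>\<close>.\<close>
lemma rotation_step:
  fixes c s C S p q :: real
  assumes "s\<^sup>2 + c\<^sup>2 = 1"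
  defines "C' \<equiv> C * (1 - 2 * s\<^sup>2) - S * (2 * s * c)" and "S' \<equiv> S * (1 - 2 * s\<^sup>2) + C * (2 * s * c)"
  defines "A \<equiv> \<lambda>C S. q * (1 - C) + p * (c - C * c - S * s)"
    and "B \<equiv> \<lambda>C S. q * (c - C * c + S * s) + p * (1 - C)"
  shows "A C' S' = A C S + (2 * s\<^sup>2 * q - 2 * A C S + 2 * c * B C S)"
    and "B C' S' = B C S + (2 * s\<^sup>2 * p - 2 * B C S + 2 * c * A C' S')"
proof -
  have s: "s\<^sup>2 = 1 - c\<^sup>2" using assms(1) by simp
  show "A C' S' = A C S + (2 * s\<^sup>2 * q - 2 * A C S + 2 * c * B C S)"
    using s unfolding A_def B_def C'_def S'_def by algebra
  show "B C' S' = B C S + (2 * s\<^sup>2 * p - 2 * B C S + 2 * c * A C' S')"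
    using s unfolding A_def B_def C'_def S'_def by algebra
qed

text \<open>Applying the reflections in \<open>y\<close> and \<open>x\<close> in turn subtracts multiples of the rows \<open>y\<close> and \<open>x\<close> of the
  form. The amounts subtracted satisfy the recursion \<open>g\<^sub>n\<^sub>+\<^sub>1 = 2 cos \<theta> g\<^sub>n - g\<^sub>n\<^sub>-\<^sub>1\<close>, hence are
  combinations of sines of multiples of \<open>\<theta>\<close>, and \<open>A\<close> and \<open>B\<close> are their telescoped sums, scaled
  by \<open>2 sin\<^sup>2 \<theta>\<close>.\<close>
lemma act_rotation:
  fixes \<Gamma> :: "'v labelled_graph" and x y :: 'v
  assumes xy: "x \<noteq> y" "{x, y} \<in> edges \<Gamma>"
  defines "\<theta> \<equiv> pi / label \<Gamma> {x, y}"
  assumes sin: "sin \<theta> \<noteq> 0"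
  defines "C \<equiv> \<lambda>j. cos (real j * (2 * \<theta>))" and "S \<equiv> \<lambda>j. sin (real j * (2 * \<theta>))"
  defines "A \<equiv> \<lambda>f j. f y * (1 - C j) + f x * (cos \<theta> - C j * cos \<theta> - S j * sin \<theta>)"
    and "B \<equiv> \<lambda>f j. f y * (cos \<theta> - C j * cos \<theta> + S j * sin \<theta>) + f x * (1 - C j)"
  shows "act \<Gamma> (alternating (x, True) (y, True) (2 * j)) f z = f z
     - reflection_coeff \<Gamma> y z * (A f j / (2 * (sin \<theta>)\<^sup>2))
     - reflection_coeff \<Gamma> x z * (B f j / (2 * (sin \<theta>)\<^sup>2))"
proof (induction j arbitrary: z)
  case 0
  then show ?case by (simp add: A_def B_def C_def S_def)
next
  case (Suc j)
  define g where "g = act \<Gamma> (alternating (x, True) (y, True) (2 * j)) f"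
  let ?s = "sin \<theta>" and ?c = "cos \<theta>"
  have C: "C (Suc j) = C j * (1 - 2 * ?s\<^sup>2) - S j * (2 * ?s * ?c)"
    by (simp add: C_def S_def distrib_right cos_add cos_double_sin sin_double)
  have S: "S (Suc j) = S j * (1 - 2 * ?s\<^sup>2) + C j * (2 * ?s * ?c)"
    by (simp add: C_def S_def distrib_right sin_add cos_double_sin sin_double)
  note step = rotation_step[OF sin_cos_squared_add[of \<theta>], where q = "f y" and p = "f x" and C = "C j" and S = "S j", folded C S]
  have coeff: "reflection_coeff \<Gamma> x y = - 2 * ?c" "reflection_coeff \<Gamma> y x = - 2 * ?c"
    "reflection_coeff \<Gamma> x x = 2" "reflection_coeff \<Gamma> y y = 2"
    using xy by (auto simp: reflection_coeff_def \<theta>_def insert_commute)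
  have gz: "g z = f z - reflection_coeff \<Gamma> y z * (A f j / (2 * ?s\<^sup>2))
     - reflection_coeff \<Gamma> x z * (B f j / (2 * ?s\<^sup>2))" for z
    using Suc by (simp add: g_def)
  have "2 * ?s\<^sup>2 * g y = 2 * ?s\<^sup>2 * f y - 2 * A f j + 2 * ?c * B f j"
    unfolding gz[of y] coeff using sin by (simp add: field_simps)
  then have A': "A f (Suc j) = A f j + 2 * ?s\<^sup>2 * g y"
    using step(1) unfolding A_def B_def by simp
  have "2 * ?s\<^sup>2 * g x = 2 * ?s\<^sup>2 * f x - 2 * B f j + 2 * ?c * A f j"
    unfolding gz[of x] coeff using sin by (simp add: field_simps)
  then have "2 * ?s\<^sup>2 * (g x + 2 * ?c * g y)
      = 2 * ?s\<^sup>2 * f x - 2 * B f j + 2 * ?c * A f (Suc j)"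
    using A' by (simp add: algebra_simps)
  then have B': "B f (Suc j) = B f j + 2 * ?s\<^sup>2 * (g x + 2 * ?c * g y)"
    using step(2) unfolding A_def B_def by simp
  have "act \<Gamma> (alternating (x, True) (y, True) (2 * Suc j)) f z
      = reflect \<Gamma> x (reflect \<Gamma> y g) z"
    by (simp add: g_def)
  also have "\<dots> = g z - reflection_coeff \<Gamma> y z * g y - reflection_coeff \<Gamma> x z * (g x + 2 * ?c * g y)"
    by (simp add: reflect_def coeff)
  also have "g y = A f (Suc j) / (2 * ?s\<^sup>2) - A f j / (2 * ?s\<^sup>2)"
    using A' sin by (simp add: field_simps)
  also have "g x + 2 * ?c * (A f (Suc j) / (2 * ?s\<^sup>2) - A f j / (2 * ?s\<^sup>2))
      = B f (Suc j) / (2 * ?s\<^sup>2) - B f j / (2 * ?s\<^sup>2)"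
    using A' B' sin by (simp add: field_simps)
  finally show ?case unfolding gz by (simp add: algebra_simps)
qed

text \<open>For two vertices without an edge the product of the reflections is unipotent, and the
  coordinates grow linearly.\<close>
lemma act_translation:
  assumes "x \<noteq> y" "{x, y} \<notin> edges \<Gamma>"
  shows "act \<Gamma> (alternating (x, True) (y, True) (2 * j)) (\<lambda>z. if z = y then 1 else 0) y = 2 * real j + 1"
    "act \<Gamma> (alternating (x, True) (y, True) (2 * j)) (\<lambda>z. if z = y then 1 else 0) x = - 2 * real j"
proof (induction j)
  case (Suc j)
  have coeff: "reflection_coeff \<Gamma> x y = - 2" "reflection_coeff \<Gamma> y x = - 2"
    "reflection_coeff \<Gamma> x x = 2" "reflection_coeff \<Gamma> y y = 2"
    using assms by (auto simp: reflection_coeff_def insert_commute)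
  case 1
  show ?case using Suc by (simp add: reflect_def coeff)
  case 2
  show ?case using Suc by (simp add: reflect_def coeff)
qed (use assms in auto)

section \<open>The Coxeter group of a labelled graph\<close>

locale coxeter_graph =
  fixes \<Gamma> :: "'v labelled_graph"
  assumes wf: "wf_labelled_graph \<Gamma>"
begin

abbreviation "W \<equiv> coxeter_group \<Gamma>"
abbreviation "s \<equiv> cox_gen \<Gamma>"

interpretation A: presentation "verts \<Gamma>" "artin_relations \<Gamma>"
  by (rule artin_presentation[OF wf])

interpretation C: presentation "verts \<Gamma>" "coxeter_relations \<Gamma>"
  by (rule coxeter_presentation[OF wf])

sublocale W: group W
  by (rule group_coxeter_group[OF wf])

lemma edge_verts: "{x, y} \<in> edges \<Gamma> \<Longrightarrow> x \<in> verts \<Gamma> \<and> y \<in> verts \<Gamma> \<and> x \<noteq> y"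
  using wf by (auto simp: wf_labelled_graph_def doubleton_eq_iff)

lemma label_ge_2: "e \<in> edges \<Gamma> \<Longrightarrow> 2 \<le> label \<Gamma> e"
  using wf by (auto simp: wf_labelled_graph_def)

lemma signed_words_Cons [simp]:
  "l # \<alpha> \<in> signed_words X \<longleftrightarrow> fst l \<in> X \<and> \<alpha> \<in> signed_words X"
  by (cases l) (auto simp: signed_words_def)

lemma signed_words_append [simp]:
  "\<alpha> @ \<beta> \<in> signed_words X \<longleftrightarrow> \<alpha> \<in> signed_words X \<and> \<beta> \<in> signed_words X"
  by (auto simp: signed_words_def)

lemma signed_words_Nil [simp]: "[] \<in> signed_words X"
  by (simp add: signed_words_def)

lemma signed_words_mono: "\<alpha> \<in> signed_words X \<Longrightarrow> X \<subseteq> Y \<Longrightarrow> \<alpha> \<in> signed_words Y"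
  by (auto simp: signed_words_def)

lemma signed_words_alternating [simp]:
  "x \<in> X \<Longrightarrow> y \<in> X \<Longrightarrow> alternating (x, e) (y, e) n \<in> signed_words X"
  using set_alternating[of "(x, e)" "(y, e)" n] by (auto simp: signed_words_def lists_eq_set)

lemma coxeter_class_letter:
  assumes x: "x \<in> verts \<Gamma>"
  shows "coxeter_class \<Gamma> [(x, e)] = s x"
proof (cases e)
  case False
  let ?r = "pres_rel (verts \<Gamma>) (coxeter_relations \<Gamma>)"
  have refl: "([(x, d)], [(x, d)]) \<in> ?r" for d
    using x by (intro pres_rel.refl) simp
  have sq: "([(x, True), (x, True)], []) \<in> ?r"
    using x by (intro pres_rel.relation) (simp add: coxeter_relations_def)
  have "([(x, False), (x, True), (x, True)], [(x, False)]) \<in> ?r"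
    using pres_rel.append[OF refl sq, of False] by simp
  moreover have "([(x, False), (x, True), (x, True)], [(x, True)]) \<in> ?r"
    using pres_rel.append[OF pres_rel.cancel[OF x, of False] refl[of True]] by simp
  ultimately have "([(x, False)], [(x, True)]) \<in> ?r"
    using pres_rel.sym pres_rel.trans by metis
  then show ?thesis
    using False by (simp add: cox_gen_def C.word_class_eqI)
qed (simp add: cox_gen_def)

text \<open>In the Coxeter group a generator is its own inverse, so signs can be ignored.\<close>
definition eval :: "'v signed_word \<Rightarrow> 'v signed_word set" where
  "eval \<alpha> = word_prod W (map (s \<circ> fst) \<alpha>)"

lemma eval_eq_class: "\<alpha> \<in> signed_words (verts \<Gamma>) \<Longrightarrow> eval \<alpha> = coxeter_class \<Gamma> \<alpha>"
proof (induction \<alpha>)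
  case Nil
  show ?case by (simp add: eval_def coxeter_group_def C.one_eq)
next
  case (Cons l \<alpha>)
  then have "eval (l # \<alpha>) = coxeter_class \<Gamma> [l] \<otimes>\<^bsub>W\<^esub> coxeter_class \<Gamma> \<alpha>"
    using coxeter_class_letter[of "fst l" "snd l"] by (simp add: eval_def)
  also have "\<dots> = coxeter_class \<Gamma> (l # \<alpha>)"
    using C.mult_word_class[of "[l]" \<alpha>] Cons.prems by (simp add: coxeter_group_def)
  finally show ?case .
qed

lemma eval_eq_iff:
  "\<alpha> \<in> signed_words (verts \<Gamma>) \<Longrightarrow> \<beta> \<in> signed_words (verts \<Gamma>) \<Longrightarrow>
     eval \<alpha> = eval \<beta> \<longleftrightarrow> (\<alpha>, \<beta>) \<in> pres_rel (verts \<Gamma>) (coxeter_relations \<Gamma>)"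
  by (simp add: eval_eq_class C.word_class_eq_iff)

lemma gen_closed [simp]: "x \<in> verts \<Gamma> \<Longrightarrow> s x \<in> carrier W"
  by (simp add: cox_gen_def coxeter_group_def C.carrier_eq)

lemma gen_square [simp]: "x \<in> verts \<Gamma> \<Longrightarrow> s x \<otimes>\<^bsub>W\<^esub> s x = \<one>\<^bsub>W\<^esub>"
proof -
  assume x: "x \<in> verts \<Gamma>"
  then have "([(x, True), (x, True)], []) \<in> pres_rel (verts \<Gamma>) (coxeter_relations \<Gamma>)"
    by (intro pres_rel.relation) (simp add: coxeter_relations_def)
  then have "eval [(x, True), (x, True)] = eval []"
    using x by (simp add: eval_eq_iff)
  then show ?thesis using x by (simp add: eval_def)
qed

lemma set_gens_word:
  "\<alpha> \<in> signed_words X \<Longrightarrow> set (map (s \<circ> fst) \<alpha>) \<subseteq> s ` X"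
  by (induction \<alpha>) auto

lemma set_gens_word_carrier:
  "\<alpha> \<in> signed_words (verts \<Gamma>) \<Longrightarrow> set (map (s \<circ> fst) \<alpha>) \<subseteq> carrier W"
  by (induction \<alpha>) auto

lemma eval_closed [simp]: "\<alpha> \<in> signed_words (verts \<Gamma>) \<Longrightarrow> eval \<alpha> \<in> carrier W"
  unfolding eval_def by (rule W.word_prod_closed[OF set_gens_word_carrier])

lemma eval_append:
  "\<alpha> \<in> signed_words (verts \<Gamma>) \<Longrightarrow> \<beta> \<in> signed_words (verts \<Gamma>) \<Longrightarrow>
     eval (\<alpha> @ \<beta>) = eval \<alpha> \<otimes>\<^bsub>W\<^esub> eval \<beta>"
  unfolding eval_def map_append by (intro W.word_prod_append set_gens_word_carrier)

lemma eval_alternating_double: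
  "x \<in> verts \<Gamma> \<Longrightarrow> y \<in> verts \<Gamma> \<Longrightarrow>
     eval (alternating (x, True) (y, True) (2 * n)) = (s x \<otimes>\<^bsub>W\<^esub> s y) [^]\<^bsub>W\<^esub> n"
  by (simp only: eval_def map_alternating o_apply fst_conv W.word_prod_alternating_double gen_closed)

lemma eval_relation:
  assumes "{x, y} \<in> edges \<Gamma>"
  shows "eval (alternating (x, True) (y, True) (label \<Gamma> {x, y}))
    = eval (alternating (y, True) (x, True) (label \<Gamma> {x, y}))"
proof -
  have "(alternating (x, True) (y, True) (label \<Gamma> {x, y}),
      alternating (y, True) (x, True) (label \<Gamma> {x, y})) \<in> coxeter_relations \<Gamma>"
    using assms by (auto simp: coxeter_relations_def artin_relations_def)
  then show ?thesis
    using edge_verts[OF assms] by (simp add: eval_eq_iff pres_rel.relation)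
qed

lemma edge_power_label:
  assumes "{x, y} \<in> edges \<Gamma>"
  shows "(s x \<otimes>\<^bsub>W\<^esub> s y) [^]\<^bsub>W\<^esub> label \<Gamma> {x, y} = \<one>\<^bsub>W\<^esub>"
proof -
  let ?m = "label \<Gamma> {x, y}"
  let ?p = "alternating (s x) (s y) ?m" and ?q = "alternating (s y) (s x) ?m"
  have xy: "x \<in> verts \<Gamma>" "y \<in> verts \<Gamma>" using edge_verts[OF assms] by auto
  have sub: "set ?p \<subseteq> s ` {x, y}" "set ?q \<subseteq> s ` {x, y}"
    using set_alternating[of "s x" "s y" ?m] set_alternating[of "s y" "s x" ?m] by auto
  then have cl: "set ?p \<subseteq> carrier W" "set ?q \<subseteq> carrier W" using xy by auto
  have "(s x \<otimes>\<^bsub>W\<^esub> s y) [^]\<^bsub>W\<^esub> ?m = word_prod W (?p @ rev ?q)"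
    using xy by (simp flip: W.word_prod_alternating_double alternating_double)
  also have "\<dots> = word_prod W ?p \<otimes>\<^bsub>W\<^esub> inv\<^bsub>W\<^esub> word_prod W ?q"
  proof -
    have "inv\<^bsub>W\<^esub> word_prod W ?q = word_prod W (rev ?q)"
      using sub xy by (intro W.inv_word_prod[OF cl(2)]) auto
    then show ?thesis using cl by (simp add: W.word_prod_append)
  qed
  also have "word_prod W ?p = word_prod W ?q"
    using eval_relation[OF assms] by (simp add: eval_def map_alternating)
  finally show ?thesis using cl by simp
qed

text \<open>A cancellation and a relation \<open>s\<^sub>x\<^sup>2 = 1\<close> add the same reflection twice, and the two sides of a
  braid relation have the same inversions in opposite order. Under concatenation the inversions of
  the second word are conjugated by the value of the first, which a relation does not change.\<close>
lemma parity_pres_rel: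
  assumes "(\<alpha>, \<beta>) \<in> pres_rel (verts \<Gamma>) (coxeter_relations \<Gamma>)" "t \<in> carrier W"
  shows "odd (count_list (inversions W (map (s \<circ> fst) \<alpha>)) t)
    = odd (count_list (inversions W (map (s \<circ> fst) \<beta>)) t)"
  using assms
proof (induction arbitrary: t)
  case (append u v u' v')
  have words: "u \<in> signed_words (verts \<Gamma>)" "v \<in> signed_words (verts \<Gamma>)"
      "u' \<in> signed_words (verts \<Gamma>)" "v' \<in> signed_words (verts \<Gamma>)"
    using append C.pres_rel_wf by auto
  have split: "count_list (inversions W (map (s \<circ> fst) (\<alpha> @ \<beta>))) t
      = count_list (inversions W (map (s \<circ> fst) \<alpha>)) t
      + count_list (inversions W (map (s \<circ> fst) \<beta>)) (conjugate W (inv\<^bsub>W\<^esub> eval \<alpha>) t)"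
    if "\<alpha> \<in> signed_words (verts \<Gamma>)" "\<beta> \<in> signed_words (verts \<Gamma>)" for \<alpha> \<beta>
    using that append.prems
    by (simp only: map_append W.inversions_append[OF set_gens_word_carrier set_gens_word_carrier]
        count_list_append W.count_list_map_conjugate[OF _ _ W.inversions_closed[OF set_gens_word_carrier]]
        eval_closed eval_def[symmetric])
  have "eval u = eval v" using words append by (simp add: eval_eq_iff)
  then show ?case
    using append.IH(1)[OF append.prems] append.IH(2)[of "conjugate W (inv\<^bsub>W\<^esub> eval v) t"]
      append.prems words
    unfolding split[OF words(1,3)] split[OF words(2,4)] by (simp add: comp_def)
next
  case (cancel x e)
  then show ?case by simp
next
  case (relation u v)
  then consider x y where "{x, y} \<in> edges \<Gamma>"
      "u = alternating (x, True) (y, True) (label \<Gamma> {x, y})"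
      "v = alternating (y, True) (x, True) (label \<Gamma> {x, y})"
    | x where "x \<in> verts \<Gamma>" "u = [(x, True), (x, True)]" "v = []"
    by (auto simp: coxeter_relations_def artin_relations_def)
  then show ?case
  proof cases
    case 1
    then have "inversions W (map (s \<circ> fst) v) = rev (inversions W (map (s \<circ> fst) u))"
      using edge_verts[OF 1(1)] edge_power_label[OF 1(1)]
      by (simp add: map_alternating W.inversions_alternating_rev)
    then show ?thesis by (simp add: comp_def)
  next
    case 2
    then show ?thesis by simp
  qed
qed simp_all

lemma list_of_gens:
  assumes "set us \<subseteq> s ` X"
  obtains xs where "us = map (s \<circ> fst) (map (\<lambda>x. (x, True)) xs)" "set xs \<subseteq> X"
proof -
  have "\<exists>xs. us = map s xs \<and> set xs \<subseteq> X"
    using assms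
  proof (induction us)
    case (Cons u us)
    then obtain xs x where "us = map s xs" "set xs \<subseteq> X" "u = s x" "x \<in> X" by auto
    then show ?case by (intro exI[of _ "x # xs"]) simp
  qed simp
  then obtain xs where "us = map s xs" "set xs \<subseteq> X" by auto
  then show ?thesis using that[of xs] by (simp add: comp_def)
qed

sublocale W: parity_group W "s ` verts \<Gamma>"
proof
  show "generate W (s ` verts \<Gamma>) = carrier W"
  proof
    show "generate W (s ` verts \<Gamma>) \<subseteq> carrier W"
      by (rule W.generate_incl) auto
    show "carrier W \<subseteq> generate W (s ` verts \<Gamma>)"
    proof
      fix w assume "w \<in> carrier W"
      then obtain \<alpha> where "\<alpha> \<in> signed_words (verts \<Gamma>)" "w = eval \<alpha>"
        by (auto simp: coxeter_group_def C.carrier_eq eval_eq_class)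
      then show "w \<in> generate W (s ` verts \<Gamma>)"
        using W.word_prod_in_generate[OF set_gens_word] by (simp add: eval_def)
    qed
  qed
next
  fix us ws t
  assume us: "set us \<subseteq> s ` verts \<Gamma>" and ws: "set ws \<subseteq> s ` verts \<Gamma>"
    and eq: "word_prod W us = word_prod W ws"
  let ?pos = "map (\<lambda>x. (x, True))"
  obtain xs where xs: "us = map (s \<circ> fst) (?pos xs)" "set xs \<subseteq> verts \<Gamma>"
    using list_of_gens[OF us] .
  obtain ys where ys: "ws = map (s \<circ> fst) (?pos ys)" "set ys \<subseteq> verts \<Gamma>"
    using list_of_gens[OF ws] .
  have words: "?pos xs \<in> signed_words (verts \<Gamma>)" "?pos ys \<in> signed_words (verts \<Gamma>)"
    using xs ys by (auto simp: signed_words_def)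
  have "eval (?pos xs) = eval (?pos ys)" using eq xs(1) ys(1) by (simp only: eval_def)
  then have "(?pos xs, ?pos ys) \<in> pres_rel (verts \<Gamma>) (coxeter_relations \<Gamma>)"
    using words by (simp add: eval_eq_iff)
  then have "odd (count_list (inversions W us) t) = odd (count_list (inversions W ws) t)"
    if "t \<in> carrier W"
    using parity_pres_rel that xs(1) ys(1) by metis
  moreover have "t \<notin> set (inversions W us)" "t \<notin> set (inversions W ws)" if "t \<notin> carrier W"
  proof -
    have "set us \<subseteq> carrier W" "set ws \<subseteq> carrier W" using us ws by auto
    then show "t \<notin> set (inversions W us)" "t \<notin> set (inversions W ws)"
      using that W.inversions_closed by blast+
  qed
  ultimately show "odd (count_list (inversions W us) t) = odd (count_list (inversions W ws) t)"
    by (cases "t \<in> carrier W") auto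
qed auto

lemma sin_label_nonzero:
  assumes "e \<in> edges \<Gamma>"
  shows "sin (pi / label \<Gamma> e) \<noteq> 0"
proof -
  have "0 < pi / label \<Gamma> e" "pi / label \<Gamma> e < pi"
    using label_ge_2[OF assms] by (auto simp: field_simps)
  then show ?thesis using sin_gt_zero by fastforce
qed

text \<open>After \<open>m\<close> steps of the rotation the angle \<open>2m\<theta>\<close> is \<open>2\<pi>\<close>.\<close>
lemma act_rotation_order:
  assumes "{x, y} \<in> edges \<Gamma>"
  shows "act \<Gamma> (alternating (x, True) (y, True) (2 * label \<Gamma> {x, y})) f = f"
proof
  fix z
  have "real (label \<Gamma> {x, y}) * (2 * (pi / label \<Gamma> {x, y})) = 2 * pi"
    using label_ge_2[OF assms] by simp
  then show "act \<Gamma> (alternating (x, True) (y, True) (2 * label \<Gamma> {x, y})) f z = f z"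
    using act_rotation[of x y \<Gamma> "label \<Gamma> {x, y}" f z] edge_verts[OF assms]
      assms sin_label_nonzero[OF assms] by simp
qed

lemma act_pres_rel:
  assumes "(\<alpha>, \<beta>) \<in> pres_rel (verts \<Gamma>) (coxeter_relations \<Gamma>)"
  shows "act \<Gamma> \<alpha> f = act \<Gamma> \<beta> f"
  using assms
proof (induction arbitrary: f)
  case (append u v u' v')
  then show ?case by (simp add: act_append)
next
  case (relation u v)
  then consider x y where "{x, y} \<in> edges \<Gamma>"
      "u = alternating (x, True) (y, True) (label \<Gamma> {x, y})"
      "v = alternating (y, True) (x, True) (label \<Gamma> {x, y})"
    | x where "x \<in> verts \<Gamma>" "u = [(x, True), (x, True)]" "v = []"
    by (auto simp: coxeter_relations_def artin_relations_def)
  then show ?case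
  proof cases
    case 1
    have "act \<Gamma> u (act \<Gamma> (rev v) (act \<Gamma> v f)) = act \<Gamma> v f"
      using act_rotation_order[OF 1(1), of "act \<Gamma> v f"]
      unfolding alternating_double act_append 1(2,3) .
    then show ?thesis by simp
  qed simp
qed auto

lemma act_power_one:
  assumes "x \<in> verts \<Gamma>" "y \<in> verts \<Gamma>" "(s x \<otimes>\<^bsub>W\<^esub> s y) [^]\<^bsub>W\<^esub> k = \<one>\<^bsub>W\<^esub>"
  shows "act \<Gamma> (alternating (x, True) (y, True) (2 * k)) f = f"
proof -
  have "eval (alternating (x, True) (y, True) (2 * k)) = eval []"
    using assms by (simp only: eval_alternating_double) (simp add: eval_def)
  then have "(alternating (x, True) (y, True) (2 * k), []) \<in> pres_rel (verts \<Gamma>) (coxeter_relations \<Gamma>)"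
    using assms by (simp add: eval_eq_iff)
  from act_pres_rel[OF this] show ?thesis by simp
qed

text \<open>Take for \<open>f\<close> the form that is \<open>1\<close> at \<open>y\<close> and \<open>0\<close> elsewhere. If it is fixed, the multiples \<open>A\<close> and \<open>B\<close>
  of the two rows cancel at \<open>x\<close> and at \<open>y\<close>; these rows are independent there, so \<open>A = 0\<close>, that
  is, \<open>2k\<theta>\<close> is a multiple of \<open>2\<pi>\<close>.\<close>
lemma edge_power_less_label:
  assumes e: "{x, y} \<in> edges \<Gamma>" and k: "0 < k" "k < label \<Gamma> {x, y}"
  shows "(s x \<otimes>\<^bsub>W\<^esub> s y) [^]\<^bsub>W\<^esub> k \<noteq> \<one>\<^bsub>W\<^esub>"
proof
  assume one: "(s x \<otimes>\<^bsub>W\<^esub> s y) [^]\<^bsub>W\<^esub> k = \<one>\<^bsub>W\<^esub>"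
  have xy: "x \<in> verts \<Gamma>" "y \<in> verts \<Gamma>" "x \<noteq> y" using edge_verts[OF e] by auto
  define m where "m = label \<Gamma> {x, y}"
  define \<theta> where "\<theta> = pi / m"
  define C where "C = cos (real k * (2 * \<theta>))"
  define f :: "'v \<Rightarrow> real" where "f = (\<lambda>z. if z = y then 1 else 0)"
  define A where "A = (1 - C) / (2 * (sin \<theta>)\<^sup>2)"
  define B where "B = (cos \<theta> - C * cos \<theta> + sin (real k * (2 * \<theta>)) * sin \<theta>) / (2 * (sin \<theta>)\<^sup>2)"
  have s: "sin \<theta> \<noteq> 0" using sin_label_nonzero[OF e] by (simp add: \<theta>_def m_def)
  have "act \<Gamma> (alternating (x, True) (y, True) (2 * k)) f z
      = f z - reflection_coeff \<Gamma> y z * A - reflection_coeff \<Gamma> x z * B" for z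
    using act_rotation[OF xy(3) e, of k f z] s xy(3)
    by (simp add: A_def B_def C_def f_def \<theta>_def m_def)
  then have zero: "reflection_coeff \<Gamma> y z * A + reflection_coeff \<Gamma> x z * B = 0" for z
    using act_power_one[OF xy(1,2) one, of f] by (simp add: algebra_simps)
  have "2 * A - 2 * cos \<theta> * B = 0" "- 2 * cos \<theta> * A + 2 * B = 0"
    using zero[of y] zero[of x] xy(3) e
    by (simp_all add: reflection_coeff_def insert_commute \<theta>_def m_def)
  then have "A = cos \<theta> * B" "B = cos \<theta> * A" by linarith+
  then have "A * (1 - (cos \<theta>)\<^sup>2) = 0" by (simp add: power2_eq_square algebra_simps)
  then have "A = 0" using s by (simp add: cos_squared_eq)
  then have "C = 1" using s by (simp add: A_def)
  then obtain n :: int where n: "real k * (2 * \<theta>) = n * (2 * pi)"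
    unfolding C_def cos_one_2pi_int by auto
  have "m > 0" using k by (simp add: m_def)
  then have "real k = n * real m" using n by (simp add: \<theta>_def field_simps)
  then have "int k = n * int m" by (metis of_int_eq_iff of_int_mult of_int_of_nat_eq)
  then have "m dvd k" by (metis dvd_triv_right int_dvd_int_iff)
  then show False using k by (auto simp: m_def dest: dvd_imp_le)
qed

lemma nonedge_power:
  fixes k :: nat
  assumes "x \<in> verts \<Gamma>" "y \<in> verts \<Gamma>" "x \<noteq> y" "{x, y} \<notin> edges \<Gamma>" "0 < k"
  shows "(s x \<otimes>\<^bsub>W\<^esub> s y) [^]\<^bsub>W\<^esub> k \<noteq> \<one>\<^bsub>W\<^esub>"
  using act_translation(2)[OF assms(3,4), of k] act_power_one[OF assms(1,2), of k] assms(3,5)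
  by auto

lemma gen_inj: "inj_on s (verts \<Gamma>)"
proof (rule inj_onI, rule ccontr)
  fix x y assume xy: "x \<in> verts \<Gamma>" "y \<in> verts \<Gamma>" "s x = s y" "x \<noteq> y"
  then have "(s x \<otimes>\<^bsub>W\<^esub> s y) [^]\<^bsub>W\<^esub> (1 :: nat) = \<one>\<^bsub>W\<^esub>" by simp
  then show False
    using edge_power_less_label[of x y 1] nonedge_power[of x y 1] label_ge_2[of "{x, y}"] xy
    by (cases "{x, y} \<in> edges \<Gamma>") fastforce+
qed

text \<open>The label of an edge can be read off from the group as the order of a product of generators, and
  this order is invariant under conjugation.\<close>
lemma edge_transfer:
  assumes e: "{x, y} \<in> edges \<Gamma>" and v: "x' \<in> verts \<Gamma>" "y' \<in> verts \<Gamma>" and w: "w \<in> carrier W"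
    and conj: "s x' = conjugate W w (s x)" "s y' = conjugate W w (s y)"
  shows "{x', y'} \<in> edges \<Gamma> \<and> label \<Gamma> {x', y'} = label \<Gamma> {x, y}"
proof -
  have xy: "x \<in> verts \<Gamma>" "y \<in> verts \<Gamma>" "x \<noteq> y" using edge_verts[OF e] by auto
  let ?c = "s x \<otimes>\<^bsub>W\<^esub> s y" and ?c' = "s x' \<otimes>\<^bsub>W\<^esub> s y'"
  have c': "?c' = conjugate W w ?c"
    using conj xy w by (simp add: W.conjugate_mult)
  have pow: "?c' [^]\<^bsub>W\<^esub> k = conjugate W w (?c [^]\<^bsub>W\<^esub> k)" for k :: nat
    using w xy by (induction k) (simp_all add: c' W.conjugate_mult)
  have iff: "?c' [^]\<^bsub>W\<^esub> k = \<one>\<^bsub>W\<^esub> \<longleftrightarrow> ?c [^]\<^bsub>W\<^esub> k = \<one>\<^bsub>W\<^esub>" for k :: nat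
    using W.conjugate_eq_iff[OF w, of "?c [^]\<^bsub>W\<^esub> k" "\<one>\<^bsub>W\<^esub>"] w xy by (simp add: pow)
  have "s x \<noteq> s y" using gen_inj xy by (auto dest: inj_onD)
  then have ne: "x' \<noteq> y'" using conj w xy by auto
  have pos: "0 < label \<Gamma> {x, y}" using label_ge_2[OF e] by simp
  have e': "{x', y'} \<in> edges \<Gamma>"
    using nonedge_power[OF v ne _ pos] edge_power_label[OF e] iff by blast
  have pos': "0 < label \<Gamma> {x', y'}" using label_ge_2[OF e'] by simp
  have "\<not> label \<Gamma> {x', y'} < label \<Gamma> {x, y}"
    using edge_power_less_label[OF e pos'] edge_power_label[OF e'] iff by blast
  moreover have "\<not> label \<Gamma> {x, y} < label \<Gamma> {x', y'}"
    using edge_power_less_label[OF e' pos] edge_power_label[OF e] iff by blast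
  ultimately show ?thesis using e' by simp
qed

section \<open>The retraction onto a standard parabolic subgroup\<close>

lemma min_part_eq: "min_part \<Gamma> X u = W.rep (s ` X) u"
  by (simp add: min_part_def minimal_rep_def coset_minimal_def minimal_in_coset_def
      cox_length_def word_length_def cox_subgroup_def)

definition gen_index :: "'v set \<Rightarrow> 'v signed_word set \<Rightarrow> 'v" where
  "gen_index X t = (THE x. x \<in> X \<and> t = s x)"

lemma gen_index_gen [simp]: "X \<subseteq> verts \<Gamma> \<Longrightarrow> x \<in> X \<Longrightarrow> gen_index X (s x) = x"
  unfolding gen_index_def using gen_inj by (intro the_equality) (auto dest: inj_onD)

text \<open>The map on words, started in an arbitrary coset \<open>W\<^sub>X u\<close>; this generality makes it
  compatible with concatenation.\<close>
primrec pi_from :: "'v set \<Rightarrow> 'v signed_word set \<Rightarrow> 'v signed_word \<Rightarrow> 'v signed_word" where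
  "pi_from X u [] = []"
| "pi_from X u (l # \<alpha>) =
     (let t = conjugate W (W.rep (s ` X) u) (s (fst l))
      in if t \<in> s ` X then [(gen_index X t, snd l)] else []) @
     pi_from X (u \<otimes>\<^bsub>W\<^esub> s (fst l)) \<alpha>"

lemma pi_from_append:
  assumes "u \<in> carrier W" "\<alpha> \<in> signed_words (verts \<Gamma>)"
  shows "pi_from X u (\<alpha> @ \<beta>) = pi_from X u \<alpha> @ pi_from X (u \<otimes>\<^bsub>W\<^esub> eval \<alpha>) \<beta>"
  using assms
proof (induction \<alpha> arbitrary: u)
  case (Cons l \<alpha>)
  have "eval (l # \<alpha>) = s (fst l) \<otimes>\<^bsub>W\<^esub> eval \<alpha>" by (simp add: eval_def)
  then show ?case using Cons by (simp add: W.m_assoc)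
qed (simp add: eval_def)

lemma prefix_elt_eq: "prefix_elt \<Gamma> \<alpha> i = eval (take i \<alpha>)"
  by (simp add: prefix_elt_def eval_def case_prod_unfold comp_def)

lemma pi_hat_letter_eq:
  assumes X: "X \<subseteq> verts \<Gamma>" and \<alpha>: "\<alpha> \<in> signed_words (verts \<Gamma>)" and i: "i < length \<alpha>"
  shows "pi_hat_letter \<Gamma> X \<alpha> i = pi_from X (eval (take i \<alpha>)) [\<alpha> ! i]"
proof -
  obtain z e where l: "\<alpha> ! i = (z, e)" by fastforce
  have z: "z \<in> verts \<Gamma>" using \<alpha> i l nth_mem[OF i] by (auto simp: signed_words_def)
  have words: "take i \<alpha> \<in> signed_words (verts \<Gamma>)"
    using \<alpha> by (metis append_take_drop_id signed_words_append)
  have u: "eval (take i \<alpha>) \<in> carrier W" using words by simp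
  have "eval (take (Suc i) \<alpha>) = eval (take i \<alpha>) \<otimes>\<^bsub>W\<^esub> s z"
    using eval_append[OF words, of "[(z, e)]"] i l z by (simp add: take_Suc_conv_app_nth eval_def)
  then have "letter_conj \<Gamma> X \<alpha> i = conjugate W (W.rep (s ` X) (eval (take i \<alpha>))) (s z)"
    using W.conjugate_rep_mult_gen[OF image_mono[OF X] u, of "s z"] z l
    by (simp add: letter_conj_def prefix_elt_eq min_part_eq conjugate_def[symmetric])
  then show ?thesis
    using l by (simp add: pi_hat_letter_def Let_def gen_index_def)
qed

lemma pi_hat_eq:
  assumes X: "X \<subseteq> verts \<Gamma>" and \<alpha>: "\<alpha> \<in> signed_words (verts \<Gamma>)"
  shows "pi_hat \<Gamma> X \<alpha> = pi_from X \<one>\<^bsub>W\<^esub> \<alpha>"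
proof -
  have "concat (map (pi_hat_letter \<Gamma> X \<alpha>) [0..<n]) = pi_from X \<one>\<^bsub>W\<^esub> (take n \<alpha>)"
    if "n \<le> length \<alpha>" for n
    using that
  proof (induction n)
    case (Suc n)
    have words: "take n \<alpha> \<in> signed_words (verts \<Gamma>)"
      using \<alpha> by (metis append_take_drop_id signed_words_append)
    have "pi_from X \<one>\<^bsub>W\<^esub> (take (Suc n) \<alpha>)
        = pi_from X \<one>\<^bsub>W\<^esub> (take n \<alpha>) @ pi_from X (eval (take n \<alpha>)) [\<alpha> ! n]"
      using Suc.prems words by (simp only: take_Suc_conv_app_nth Suc_le_eq pi_from_append
          W.one_closed W.l_one eval_closed)
    then show ?case using Suc pi_hat_letter_eq[OF X \<alpha>, of n] by simp
  qed simp
  from this[of "length \<alpha>"] show ?thesis by (simp add: pi_hat_def)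
qed

lemma pi_from_words:
  assumes X: "X \<subseteq> verts \<Gamma>"
  shows "pi_from X u \<alpha> \<in> signed_words X"
  using X by (induction \<alpha> arbitrary: u) (auto simp: Let_def)

lemma gens_pi_from:
  assumes X: "X \<subseteq> verts \<Gamma>"
  shows "map (s \<circ> fst) (pi_from X u \<alpha>) = W.trace (s ` X) u (map (s \<circ> fst) \<alpha>)"
  using X by (induction \<alpha> arbitrary: u) (auto simp: Let_def)

lemma pi_from_positive:
  assumes "X \<subseteq> verts \<Gamma>" "\<And>l. l \<in> set \<alpha> \<Longrightarrow> snd l"
  shows "pi_from X u \<alpha> = map (\<lambda>t. (gen_index X t, True)) (W.trace (s ` X) u (map (s \<circ> fst) \<alpha>))"
  using assms by (induction \<alpha> arbitrary: u) (auto simp: Let_def)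

lemma pi_from_parabolic_word:
  assumes X: "X \<subseteq> verts \<Gamma>" and u: "u \<in> generate W (s ` X)" and \<alpha>: "\<alpha> \<in> signed_words X"
  shows "pi_from X u \<alpha> = \<alpha>"
  using u \<alpha>
proof (induction \<alpha> arbitrary: u)
  case (Cons l \<alpha>)
  have l: "fst l \<in> X" "fst l \<in> verts \<Gamma>" using Cons.prems X by auto
  have "u \<otimes>\<^bsub>W\<^esub> s (fst l) \<in> generate W (s ` X)"
    by (rule generate.eng[OF Cons.prems(1) generate.incl[OF imageI[OF l(1)]]])
  moreover have "W.rep (s ` X) u = \<one>\<^bsub>W\<^esub>"
    using W.rep_parabolic[OF image_mono[OF X] Cons.prems(1)] .
  ultimately show ?case using Cons l X by (simp add: Let_def)
qed simp

text \<open>The two sides of a relation print either the same word or, by \<open>edge_transfer\<close>, the two sides of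
  another relation with the same label.\<close>
lemma pi_from_relation:
  assumes X: "X \<subseteq> verts \<Gamma>" and u: "u \<in> carrier W" and e: "{x, y} \<in> edges \<Gamma>"
  defines "m \<equiv> label \<Gamma> {x, y}"
  shows "(pi_from X u (alternating (x, True) (y, True) m),
     pi_from X u (alternating (y, True) (x, True) m)) \<in> pres_rel (verts \<Gamma>) (artin_relations \<Gamma>)"
proof -
  have xy: "x \<in> verts \<Gamma>" "y \<in> verts \<Gamma>" using edge_verts[OF e] by auto
  let ?p = "alternating (s x) (s y) m" and ?q = "alternating (s y) (s x) m"
  let ?read = "map (\<lambda>t. (gen_index X t, True))"
  have read: "pi_from X u (alternating (a, True) (b, True) m)
      = ?read (W.trace (s ` X) u (alternating (s a) (s b) m))" for a b
  proof -
    have "snd l" if "l \<in> set (alternating (a, True) (b, True) m)" for l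
      using that set_alternating[of "(a, True)" "(b, True)" m] by auto
    then show ?thesis using pi_from_positive[OF X] by (simp add: map_alternating)
  qed
  have pows: "(s x \<otimes>\<^bsub>W\<^esub> s y) [^]\<^bsub>W\<^esub> k \<noteq> \<one>\<^bsub>W\<^esub>" "(s y \<otimes>\<^bsub>W\<^esub> s x) [^]\<^bsub>W\<^esub> k \<noteq> \<one>\<^bsub>W\<^esub>"
    if "0 < k" "k < m" for k :: nat
    using edge_power_less_label[OF e] edge_power_less_label[of y x k] e that
    by (auto simp: m_def insert_commute)
  have dist: "distinct (inversions W ?p)" "distinct (inversions W ?q)"
    using pows xy by (auto intro!: W.distinct_inversions_alternating)
  have eq: "word_prod W ?p = word_prod W ?q"
    using eval_relation[OF e] by (simp add: eval_def map_alternating m_def)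
  have sets: "set ?p \<subseteq> {s x, s y}" "set ?q \<subseteq> {s x, s y}"
    using set_alternating[of "s x" "s y" m] set_alternating[of "s y" "s x" m] by auto
  from W.trace_dihedral[OF image_mono[OF X] _ _ u sets(1) dist(1) sets(2) dist(2) eq] xy
  consider "W.trace (s ` X) u ?p = W.trace (s ` X) u ?q"
    | w where "w \<in> carrier W" "conjugate W w (s x) \<in> s ` X" "conjugate W w (s y) \<in> s ` X"
       "W.trace (s ` X) u ?p = map (conjugate W w) ?p"
       "W.trace (s ` X) u ?q = map (conjugate W w) ?q"
    by auto
  then show ?thesis
  proof cases
    case 1
    have "pi_from X u (alternating (x, True) (y, True) m) \<in> signed_words (verts \<Gamma>)"
      by (rule signed_words_mono[OF pi_from_words[OF X] X])
    then show ?thesis using 1 read by (simp add: pres_rel.refl)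
  next
    case 2
    then obtain x' y' where x'y': "x' \<in> X" "y' \<in> X"
        "s x' = conjugate W w (s x)" "s y' = conjugate W w (s y)" by auto
    then have "{x', y'} \<in> edges \<Gamma>" "label \<Gamma> {x', y'} = m"
      using edge_transfer[OF e _ _ 2(1) x'y'(3,4)] x'y'(1,2) X m_def by auto
    then have "(alternating (x', True) (y', True) m, alternating (y', True) (x', True) m)
        \<in> artin_relations \<Gamma>"
      unfolding artin_relations_def by blast
    moreover have "pi_from X u (alternating (x, True) (y, True) m) = alternating (x', True) (y', True) m"
      "pi_from X u (alternating (y, True) (x, True) m) = alternating (y', True) (x', True) m"
      using x'y' X by (simp_all add: read 2(4,5) map_alternating flip: x'y'(3,4) del: map_map)
    ultimately show ?thesis by (simp add: pres_rel.relation)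
  qed
qed

lemma pi_from_pres_rel:
  assumes X: "X \<subseteq> verts \<Gamma>" and "(\<alpha>, \<beta>) \<in> pres_rel (verts \<Gamma>) (artin_relations \<Gamma>)" "u \<in> carrier W"
  shows "(pi_from X u \<alpha>, pi_from X u \<beta>) \<in> pres_rel (verts \<Gamma>) (artin_relations \<Gamma>)"
  using assms(2,3)
proof (induction arbitrary: u)
  case (refl \<alpha>)
  show ?case
    by (rule pres_rel.refl[OF signed_words_mono[OF pi_from_words[OF X] X]])
next
  case (sym \<alpha> \<beta>)
  then show ?case by (blast intro: pres_rel.sym)
next
  case (trans \<alpha> \<beta> \<gamma>)
  then show ?case by (blast intro: pres_rel.trans)
next
  case (append \<alpha> \<beta> \<alpha>' \<beta>')
  have words: "\<alpha> \<in> signed_words (verts \<Gamma>)" "\<beta> \<in> signed_words (verts \<Gamma>)"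
    using append.hyps(1) A.pres_rel_wf by auto
  have "(\<alpha>, \<beta>) \<in> pres_rel (verts \<Gamma>) (coxeter_relations \<Gamma>)"
    by (rule pres_rel_mono[OF append.hyps(1)]) (simp add: coxeter_relations_def)
  then have "eval \<alpha> = eval \<beta>" using words by (simp add: eval_eq_iff)
  then show ?case
    using append.IH(1)[OF append.prems] append.IH(2)[of "u \<otimes>\<^bsub>W\<^esub> eval \<beta>"] append.prems words
    by (simp add: pi_from_append pres_rel.append)
next
  case (cancel x e)
  have sx: "s x \<in> s ` verts \<Gamma>" using cancel by simp
  let ?t = "conjugate W (W.rep (s ` X) u) (s x)"
  have "conjugate W (W.rep (s ` X) (u \<otimes>\<^bsub>W\<^esub> s x)) (s x) = ?t"
    by (rule W.conjugate_rep_mult_gen[OF image_mono[OF X] cancel.prems sx])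
  then have "pi_from X u [(x, e), (x, \<not> e)]
      = (if ?t \<in> s ` X then [(gen_index X ?t, e), (gen_index X ?t, \<not> e)] else [])"
    by (simp add: Let_def)
  moreover have "gen_index X ?t \<in> verts \<Gamma>" if "?t \<in> s ` X" using that X by auto
  ultimately show ?case by (auto intro: pres_rel.cancel pres_rel.refl)
next
  case (relation \<alpha> \<beta>)
  then show ?case using pi_from_relation[OF X] by (auto simp: artin_relations_def)
qed

text \<open>The value of the output is the component in \<open>W\<^sub>X\<close> of the value of the input.\<close>
lemma eval_pi_from_one:
  assumes X: "X \<subseteq> verts \<Gamma>" and \<alpha>: "\<alpha> \<in> signed_words (verts \<Gamma>)" and one: "eval \<alpha> = \<one>\<^bsub>W\<^esub>"
  shows "eval (pi_from X \<one>\<^bsub>W\<^esub> \<alpha>) = \<one>\<^bsub>W\<^esub>"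
proof -
  have rep: "W.rep (s ` X) \<one>\<^bsub>W\<^esub> = \<one>\<^bsub>W\<^esub>"
    using W.rep_parabolic[OF image_mono[OF X] generate.one] .
  have "pi_from X \<one>\<^bsub>W\<^esub> \<alpha> \<in> signed_words (verts \<Gamma>)"
    by (rule signed_words_mono[OF pi_from_words[OF X] X])
  then have "eval (pi_from X \<one>\<^bsub>W\<^esub> \<alpha>) \<in> carrier W" by simp
  then show ?thesis
    using W.trace_word_prod[OF image_mono[OF X] set_gens_word[OF \<alpha>], of "\<one>\<^bsub>W\<^esub>" "\<one>\<^bsub>W\<^esub>"]
      rep one gens_pi_from[OF X, of "\<one>\<^bsub>W\<^esub>" \<alpha>]
    by (simp add: eval_def)
qed

lemma artin_subgroup_eq:
  assumes X: "X \<subseteq> verts \<Gamma>"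
  shows "artin_subgroup \<Gamma> X = artin_class \<Gamma> ` signed_words X"
proof
  have sub: "\<alpha> \<in> signed_words (verts \<Gamma>)" if "\<alpha> \<in> signed_words X" for \<alpha>
    by (rule signed_words_mono[OF that X])
  interpret Ag: group "artin_group \<Gamma>" by (rule group_artin_group[OF wf])
  have mult: "artin_class \<Gamma> \<alpha> \<otimes>\<^bsub>artin_group \<Gamma>\<^esub> artin_class \<Gamma> \<beta> = artin_class \<Gamma> (\<alpha> @ \<beta>)"
    if "\<alpha> \<in> signed_words (verts \<Gamma>)" "\<beta> \<in> signed_words (verts \<Gamma>)" for \<alpha> \<beta>
    using that A.mult_word_class by (simp add: artin_group_def)
  have one: "\<one>\<^bsub>artin_group \<Gamma>\<^esub> = artin_class \<Gamma> []"
    by (simp add: artin_group_def A.one_eq)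
  have closed: "artin_class \<Gamma> \<alpha> \<in> carrier (artin_group \<Gamma>)" if "\<alpha> \<in> signed_words (verts \<Gamma>)" for \<alpha>
    using that by (simp add: artin_group_def A.carrier_eq)
  have inv_letter: "inv\<^bsub>artin_group \<Gamma>\<^esub> artin_gen \<Gamma> x = artin_class \<Gamma> [(x, False)]" if "x \<in> X" for x
  proof (rule Ag.inv_equality)
    have x: "x \<in> verts \<Gamma>" using that X by auto
    show "artin_class \<Gamma> [(x, False)] \<otimes>\<^bsub>artin_group \<Gamma>\<^esub> artin_gen \<Gamma> x = \<one>\<^bsub>artin_group \<Gamma>\<^esub>"
      using x pres_rel.cancel[OF x, of False] A.word_class_eqI
      by (simp add: artin_gen_def mult one)
    show "artin_gen \<Gamma> x \<in> carrier (artin_group \<Gamma>)"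
      "artin_class \<Gamma> [(x, False)] \<in> carrier (artin_group \<Gamma>)"
      using x closed by (simp_all add: artin_gen_def)
  qed
  show "artin_subgroup \<Gamma> X \<subseteq> artin_class \<Gamma> ` signed_words X"
  proof
    fix a assume "a \<in> artin_subgroup \<Gamma> X"
    then show "a \<in> artin_class \<Gamma> ` signed_words X"
      unfolding artin_subgroup_def
    proof induction
      case one
      then show ?case using \<open>\<one>\<^bsub>artin_group \<Gamma>\<^esub> = artin_class \<Gamma> []\<close> by auto
    next
      case (incl h)
      then show ?case by (auto simp: artin_gen_def)
    next
      case (inv h)
      then show ?case using inv_letter by auto
    next
      case (eng h1 h2)
      obtain \<alpha> \<beta> where h: "\<alpha> \<in> signed_words X" "h1 = artin_class \<Gamma> \<alpha>"
          "\<beta> \<in> signed_words X" "h2 = artin_class \<Gamma> \<beta>" using eng.IH by auto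
      have "\<alpha> @ \<beta> \<in> signed_words X" using h(1,3) by simp
      then show ?case unfolding h(2,4) mult[OF sub[OF h(1)] sub[OF h(3)]] by (rule imageI)
    qed
  qed
  show "artin_class \<Gamma> ` signed_words X \<subseteq> artin_subgroup \<Gamma> X"
  proof
    fix a assume "a \<in> artin_class \<Gamma> ` signed_words X"
    then obtain \<alpha> where \<alpha>: "\<alpha> \<in> signed_words X" "a = artin_class \<Gamma> \<alpha>" by auto
    have "artin_class \<Gamma> \<alpha> \<in> generate (artin_group \<Gamma>) (artin_gen \<Gamma> ` X)"
      using \<alpha>(1)
    proof (induction \<alpha>)
      case Nil
      then show ?case using generate.one one by metis
    next
      case (Cons l \<alpha>)
      obtain x e where l: "l = (x, e)" by fastforce
      have x: "x \<in> X" using Cons.prems l by simp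
      have "artin_class \<Gamma> [l] \<in> generate (artin_group \<Gamma>) (artin_gen \<Gamma> ` X)"
        using generate.incl[of "artin_gen \<Gamma> x" "artin_gen \<Gamma> ` X" "artin_group \<Gamma>"]
          generate.inv[of "artin_gen \<Gamma> x" "artin_gen \<Gamma> ` X" "artin_group \<Gamma>"] x l
          inv_letter[OF x] by (cases e) (auto simp: artin_gen_def)
      then have "artin_class \<Gamma> [l] \<otimes>\<^bsub>artin_group \<Gamma>\<^esub> artin_class \<Gamma> \<alpha>
          \<in> generate (artin_group \<Gamma>) (artin_gen \<Gamma> ` X)"
        using Cons by (intro generate.eng) auto
      then show ?case using mult[of "[l]" \<alpha>] sub[OF Cons.prems] by simp
    qed
    then show "a \<in> artin_subgroup \<Gamma> X" using \<alpha>(2) by (simp add: artin_subgroup_def)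
  qed
qed

lemma colored_artin_eq:
  "colored_artin \<Gamma> = artin_class \<Gamma> ` {\<alpha> \<in> signed_words (verts \<Gamma>). eval \<alpha> = \<one>\<^bsub>W\<^esub>}"
proof -
  have \<theta>: "artin_to_coxeter \<Gamma> (artin_class \<Gamma> \<alpha>) = eval \<alpha>" if "\<alpha> \<in> signed_words (verts \<Gamma>)" for \<alpha>
    using artin_to_coxeter_class[OF wf that] eval_eq_class[OF that] by simp
  have carrier: "carrier (artin_group \<Gamma>) = artin_class \<Gamma> ` signed_words (verts \<Gamma>)"
    by (simp only: artin_group_def A.carrier_eq)
  have mem: "a \<in> colored_artin \<Gamma> \<longleftrightarrow>
      a \<in> carrier (artin_group \<Gamma>) \<and> artin_to_coxeter \<Gamma> a = \<one>\<^bsub>W\<^esub>" for a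
    by (simp only: colored_artin_def kernel_def mem_Collect_eq)
  show ?thesis
  proof (intro equalityI subsetI)
    fix a assume "a \<in> colored_artin \<Gamma>"
    then have a: "a \<in> artin_class \<Gamma> ` signed_words (verts \<Gamma>)" "artin_to_coxeter \<Gamma> a = \<one>\<^bsub>W\<^esub>"
      unfolding mem carrier by (rule conjunct1, rule conjunct2)
    from a(1) obtain \<alpha> where \<alpha>: "a = artin_class \<Gamma> \<alpha>" "\<alpha> \<in> signed_words (verts \<Gamma>)" by (rule imageE)
    have "eval \<alpha> = \<one>\<^bsub>W\<^esub>" using \<theta>[OF \<alpha>(2)] a(2) \<alpha>(1) by simp
    then show "a \<in> artin_class \<Gamma> ` {\<alpha> \<in> signed_words (verts \<Gamma>). eval \<alpha> = \<one>\<^bsub>W\<^esub>}"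
      using \<alpha> by simp
  next
    fix a assume "a \<in> artin_class \<Gamma> ` {\<alpha> \<in> signed_words (verts \<Gamma>). eval \<alpha> = \<one>\<^bsub>W\<^esub>}"
    then obtain \<alpha> where \<alpha>: "a = artin_class \<Gamma> \<alpha>" "\<alpha> \<in> signed_words (verts \<Gamma>)" "eval \<alpha> = \<one>\<^bsub>W\<^esub>"
      by (elim imageE CollectE conjE)
    show "a \<in> colored_artin \<Gamma>"
      unfolding mem carrier using \<theta>[OF \<alpha>(2)] \<alpha>(3) imageI[OF \<alpha>(2)]
      unfolding \<alpha>(1) by (intro conjI) (assumption | simp only:)+
  qed
qed

end

theorem proposition2p3:
  fixes \<Gamma> :: "'v labelled_graph" and X :: "'v set"
  assumes "wf_labelled_graph \<Gamma>" and "X \<subseteq> verts \<Gamma>"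
  shows "pi_hat \<Gamma> X \<in> signed_words (verts \<Gamma>) \<rightarrow> signed_words X \<and>
    (\<forall>\<alpha>\<in>signed_words (verts \<Gamma>). \<forall>\<beta>\<in>signed_words (verts \<Gamma>).
       artin_class \<Gamma> \<alpha> = artin_class \<Gamma> \<beta> \<longrightarrow>
       artin_class \<Gamma> (pi_hat \<Gamma> X \<alpha>) = artin_class \<Gamma> (pi_hat \<Gamma> X \<beta>)) \<and>
    (\<exists>\<pi> \<in> carrier (artin_group \<Gamma>) \<rightarrow> artin_subgroup \<Gamma> X.
       (\<forall>\<alpha>\<in>signed_words (verts \<Gamma>). \<pi> (artin_class \<Gamma> \<alpha>) = artin_class \<Gamma> (pi_hat \<Gamma> X \<alpha>)) \<and>
       (\<forall>a\<in>artin_subgroup \<Gamma> X. \<pi> a = a) \<and>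
       \<pi> \<in> hom (artin_group \<Gamma>\<lparr>carrier := colored_artin \<Gamma>\<rparr>)
               (artin_group \<Gamma>\<lparr>carrier := colored_artin_sub \<Gamma> X\<rparr>))"
proof -
  interpret coxeter_graph \<Gamma> by unfold_locales (rule assms(1))
  interpret A: presentation "verts \<Gamma>" "artin_relations \<Gamma>"
    by (rule artin_presentation[OF assms(1)])
  note X = assms(2)
  let ?V = "signed_words (verts \<Gamma>)" and ?cls = "artin_class \<Gamma>" and ?pi = "pi_from X \<one>\<^bsub>W\<^esub>"
  have sub: "\<alpha> \<in> ?V" if "\<alpha> \<in> signed_words X" for \<alpha>
    by (rule signed_words_mono[OF that X])
  have invariant: "?cls (?pi \<alpha>) = ?cls (?pi \<beta>)" if "\<alpha> \<in> ?V" "\<beta> \<in> ?V" "?cls \<alpha> = ?cls \<beta>" for \<alpha> \<beta>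
    using pi_from_pres_rel[OF X, of \<alpha> \<beta>] that A.word_class_eqI by (simp add: A.word_class_eq_iff)
  define \<pi> where "\<pi> a = ?cls (?pi (SOME \<alpha>. \<alpha> \<in> ?V \<and> ?cls \<alpha> = a))" for a
  have \<pi>: "\<pi> (?cls \<alpha>) = ?cls (?pi \<alpha>)" if "\<alpha> \<in> ?V" for \<alpha>
  proof -
    have "(SOME \<beta>. \<beta> \<in> ?V \<and> ?cls \<beta> = ?cls \<alpha>) \<in> ?V
        \<and> ?cls (SOME \<beta>. \<beta> \<in> ?V \<and> ?cls \<beta> = ?cls \<alpha>) = ?cls \<alpha>"
      by (rule someI[of _ \<alpha>]) (use that in simp)
    then show ?thesis unfolding \<pi>_def using invariant that by blast
  qed
  have mult: "?cls \<alpha> \<otimes>\<^bsub>artin_group \<Gamma>\<^esub> ?cls \<beta> = ?cls (\<alpha> @ \<beta>)" if "\<alpha> \<in> ?V" "\<beta> \<in> ?V" for \<alpha> \<beta>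
    using that A.mult_word_class by (simp add: artin_group_def)
  have to_subgroup: "\<pi> \<in> carrier (artin_group \<Gamma>) \<rightarrow> artin_subgroup \<Gamma> X"
    using pi_from_words[OF X]
    by (auto simp: artin_group_def A.carrier_eq \<pi> artin_subgroup_eq[OF X])
  have retract: "\<pi> a = a" if "a \<in> artin_subgroup \<Gamma> X" for a
    using that sub pi_from_parabolic_word[OF X generate.one] by (auto simp: artin_subgroup_eq[OF X] \<pi>)
  have hom: "\<pi> \<in> hom (artin_group \<Gamma>\<lparr>carrier := colored_artin \<Gamma>\<rparr>)
               (artin_group \<Gamma>\<lparr>carrier := colored_artin_sub \<Gamma> X\<rparr>)"
  proof (rule homI)
    fix a assume "a \<in> carrier (artin_group \<Gamma>\<lparr>carrier := colored_artin \<Gamma>\<rparr>)"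
    then obtain \<alpha> where \<alpha>: "\<alpha> \<in> ?V" "eval \<alpha> = \<one>\<^bsub>W\<^esub>" "a = ?cls \<alpha>"
      by (auto simp: colored_artin_eq)
    then show "\<pi> a \<in> carrier (artin_group \<Gamma>\<lparr>carrier := colored_artin_sub \<Gamma> X\<rparr>)"
      using eval_pi_from_one[OF X] pi_from_words[OF X] sub
      by (auto simp: \<pi> colored_artin_sub_def colored_artin_eq artin_subgroup_eq[OF X])
    fix b assume "b \<in> carrier (artin_group \<Gamma>\<lparr>carrier := colored_artin \<Gamma>\<rparr>)"
    then obtain \<beta> where \<beta>: "\<beta> \<in> ?V" "eval \<beta> = \<one>\<^bsub>W\<^esub>" "b = ?cls \<beta>"
      by (auto simp: colored_artin_eq)
    have "?pi (\<alpha> @ \<beta>) = ?pi \<alpha> @ ?pi \<beta>"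
      using pi_from_append[OF W.one_closed \<alpha>(1)] \<alpha>(2) by simp
    then show "\<pi> (a \<otimes>\<^bsub>artin_group \<Gamma>\<lparr>carrier := colored_artin \<Gamma>\<rparr>\<^esub> b) =
        \<pi> a \<otimes>\<^bsub>artin_group \<Gamma>\<lparr>carrier := colored_artin_sub \<Gamma> X\<rparr>\<^esub> \<pi> b"
      using \<alpha> \<beta> pi_from_words[OF X] sub by (simp add: mult \<pi>)
  qed
  have words: "pi_hat \<Gamma> X \<in> ?V \<rightarrow> signed_words X"
    using pi_from_words[OF X] by (auto simp: pi_hat_eq[OF X])
  have induced: "\<forall>\<alpha>\<in>?V. \<forall>\<beta>\<in>?V. ?cls \<alpha> = ?cls \<beta> \<longrightarrow>
      ?cls (pi_hat \<Gamma> X \<alpha>) = ?cls (pi_hat \<Gamma> X \<beta>)"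
    by (intro ballI impI) (simp only: pi_hat_eq[OF X], rule invariant)
  have "\<forall>\<alpha>\<in>?V. \<pi> (?cls \<alpha>) = ?cls (pi_hat \<Gamma> X \<alpha>)"
    using \<pi> by (simp add: pi_hat_eq[OF X])
  then have "\<exists>\<pi> \<in> carrier (artin_group \<Gamma>) \<rightarrow> artin_subgroup \<Gamma> X.
      (\<forall>\<alpha>\<in>?V. \<pi> (?cls \<alpha>) = ?cls (pi_hat \<Gamma> X \<alpha>)) \<and>
      (\<forall>a\<in>artin_subgroup \<Gamma> X. \<pi> a = a) \<and>
      \<pi> \<in> hom (artin_group \<Gamma>\<lparr>carrier := colored_artin \<Gamma>\<rparr>)
              (artin_group \<Gamma>\<lparr>carrier := colored_artin_sub \<Gamma> X\<rparr>)"
    using to_subgroup retract hom by - (rule bexI[of _ \<pi>], fast+)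
  then show ?thesis using words induced by (intro conjI)
qed

end
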